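(* Let $G$ be a profinite group such that every dense subgroup of $G$ is separable. If $G$ is also pronilpotent, then $G$ is metrizable.
   Context: All topological groups are assumed to be Hausdorff. A profinite group is a totally disconnected compact group. A topological group is called pronilpotent if it is the limit of an inverse system of finite discrete nilpotent groups; equivalently, if it can be embedded as a closed subgroup into a direct product of finite discrete nilpotent groups. A topological space is separable if it has a countable (possibly finite) dense subset; subgroups carry the subspace topology. *)

theory Defs
  imports "HOL-Analysis.Analysis" "HOL-Algebra.Product_Groups"
begin

text \<open>All topological groups are Hausdorff by convention.\<close>

locale topological_group = group G for G (structure) +
  fixes T :: "'a topology"
  assumes topspace_eq_carrier: "topspace T = carrier G"
    and continuous_mult: "continuous_map (prod_topology T T) T (\<lambda>(x, y). x \<otimes> y)"
    and continuous_inv: "continuous_map T T (\<lambda>x. inv x)"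
    and Hausdorff: "Hausdorff_space T"

definition totally_disconnected_space :: "'a topology \<Rightarrow> bool"
  where "totally_disconnected_space T \<longleftrightarrow>
    (\<forall>x \<in> topspace T. connected_component_of_set T x = {x})"

definition profinite_group :: "('a, 'b) monoid_scheme \<Rightarrow> 'a topology \<Rightarrow> bool"
  where "profinite_group G T \<longleftrightarrow>
    topological_group G T \<and> compact_space T \<and> totally_disconnected_space T"

primrec lower_central_series :: "('a, 'b) monoid_scheme \<Rightarrow> nat \<Rightarrow> 'a set"
  where
    "lower_central_series G 0 = carrier G"
  | "lower_central_series G (Suc n) =
      generate G (\<Union>x \<in> lower_central_series G n. \<Union>y \<in> carrier G.
        {x \<otimes>\<^bsub>G\<^esub> y \<otimes>\<^bsub>G\<^esub> inv\<^bsub>G\<^esub> x \<otimes>\<^bsub>G\<^esub> inv\<^bsub>G\<^esub> y})"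

definition nilpotent_group :: "('a, 'b) monoid_scheme \<Rightarrow> bool"
  where "nilpotent_group G \<longleftrightarrow> group G \<and> (\<exists>n. lower_central_series G n = {\<one>\<^bsub>G\<^esub>})"

definition directed_set :: "'i set \<Rightarrow> ('i \<Rightarrow> 'i \<Rightarrow> bool) \<Rightarrow> bool"
  where "directed_set I leq \<longleftrightarrow>
    I \<noteq> {} \<and>
    (\<forall>i\<in>I. leq i i) \<and>
    (\<forall>i\<in>I. \<forall>j\<in>I. \<forall>k\<in>I. leq i j \<longrightarrow> leq j k \<longrightarrow> leq i k) \<and>
    (\<forall>i\<in>I. \<forall>j\<in>I. \<exists>k\<in>I. leq i k \<and> leq j k)"

text \<open>For \<open>leq j i\<close> the transition map \<open>\<phi> i j\<close> goes from \<open>H i\<close> to \<open>H j\<close>. The groups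
  carry the discrete topology, so there is no continuity condition on the transition maps.\<close>

definition inverse_system ::
    "'i set \<Rightarrow> ('i \<Rightarrow> 'i \<Rightarrow> bool) \<Rightarrow> ('i \<Rightarrow> 'h monoid) \<Rightarrow> ('i \<Rightarrow> 'i \<Rightarrow> 'h \<Rightarrow> 'h) \<Rightarrow> bool"
  where "inverse_system I leq H \<phi> \<longleftrightarrow>
    directed_set I leq \<and>
    (\<forall>i\<in>I. group (H i)) \<and>
    (\<forall>i\<in>I. \<forall>j\<in>I. leq j i \<longrightarrow> \<phi> i j \<in> hom (H i) (H j)) \<and>
    (\<forall>i\<in>I. \<forall>x \<in> carrier (H i). \<phi> i i x = x) \<and>
    (\<forall>i\<in>I. \<forall>j\<in>I. \<forall>k\<in>I. leq j i \<longrightarrow> leq k j \<longrightarrow>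
      (\<forall>x \<in> carrier (H i). \<phi> j k (\<phi> i j x) = \<phi> i k x))"

definition inverse_limit_group ::
    "'i set \<Rightarrow> ('i \<Rightarrow> 'i \<Rightarrow> bool) \<Rightarrow> ('i \<Rightarrow> 'h monoid) \<Rightarrow> ('i \<Rightarrow> 'i \<Rightarrow> 'h \<Rightarrow> 'h)
      \<Rightarrow> ('i \<Rightarrow> 'h) monoid"
  where "inverse_limit_group I leq H \<phi> = product_group I H
    \<lparr>carrier := {x \<in> carrier (product_group I H).
      \<forall>i\<in>I. \<forall>j\<in>I. leq j i \<longrightarrow> \<phi> i j (x i) = x j}\<rparr>"

definition inverse_limit_topology ::
    "'i set \<Rightarrow> ('i \<Rightarrow> 'i \<Rightarrow> bool) \<Rightarrow> ('i \<Rightarrow> 'h monoid) \<Rightarrow> ('i \<Rightarrow> 'i \<Rightarrow> 'h \<Rightarrow> 'h)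
      \<Rightarrow> ('i \<Rightarrow> 'h) topology"
  where "inverse_limit_topology I leq H \<phi> =
    subtopology (product_topology (\<lambda>i. discrete_topology (carrier (H i))) I)
      (carrier (inverse_limit_group I leq H \<phi>))"

text \<open>HOL cannot quantify existentially over types, so the types \<open>'i\<close> of indices and \<open>'h\<close> of
  group elements of the inverse system are parameters of the predicate. A theorem that
  assumes it with free type variables \<open>'i\<close> and \<open>'h\<close> covers inverse systems of any size.\<close>

definition pronilpotent_group ::
    "'i itself \<Rightarrow> 'h itself \<Rightarrow> ('a, 'b) monoid_scheme \<Rightarrow> 'a topology \<Rightarrow> bool"
  where "pronilpotent_group _ _ G T \<longleftrightarrow>
    topological_group G T \<and>
    (\<exists>(I :: 'i set) leq (H :: 'i \<Rightarrow> 'h monoid) \<phi> f.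
      inverse_system I leq H \<phi> \<and>
      (\<forall>i\<in>I. finite (carrier (H i)) \<and> nilpotent_group (H i)) \<and>
      f \<in> iso G (inverse_limit_group I leq H \<phi>) \<and>
      homeomorphic_map T (inverse_limit_topology I leq H \<phi>) f)"

end

theory Submission
  imports Defs "HOL-Algebra.Zassenhaus" "HOL-Number_Theory.Cong"
begin

text \<open>
  Metrizability is proved in the form "\<open>G\<close> has only countably many open normal subgroups". These
  separate points, so \<open>G\<close> embeds into the product of its finite discrete coset spaces, which is
  metrizable when there are countably many of them
  (\<open>metrizable_if_countable_open_normal_subgroups\<close>). Pronilpotency enters
  as follows: the open normal subgroups that contain some term of the lower central series form a
  neighbourhood base of the identity (\<open>pronilpotent_imp_small_open_normal\<close>). The count has two
  halves.

  \<^emph>\<open>Dense subgroups bound the maximal open subgroups.\<close> Call a family \<open>\<B>\<close> of maximal open normal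
  subgroups independent if no \<open>M \<in> \<B>\<close> contains the intersection of the others. The elements of \<open>G\<close>
  that lie in all but finitely many members of \<open>\<B>\<close> form a subgroup \<open>D\<close>, the analogue of the direct
  sum inside a product. No maximal open normal subgroup contains \<open>D\<close>, and residual nilpotency puts
  every proper open subgroup into such a subgroup, so \<open>D\<close> is dense. Countably many
  elements of \<open>D\<close> are outside only countably many members of \<open>\<B>\<close> altogether; if \<open>\<B>\<close> is
  uncountable, they all lie in some \<open>M \<in> \<B>\<close>, which is closed and does not contain \<open>D\<close>. Hence
  separability of dense subgroups makes every independent family countable. For a
  maximal independent \<open>\<B>\<close> an exchange argument shows that \<open>\<Inter>\<B>\<close> is contained in every maximal open
  normal subgroup \<open>M'\<close>; by compactness \<open>M'\<close> contains a finite subintersection, and an open subgroup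
  has only finitely many overgroups. So there are only countably many maximal open normal subgroups,
  and consequently only countably many continuous homomorphisms \<open>G \<rightarrow> \<int>/p\<close> for each prime \<open>p\<close>.

  \<^emph>\<open>Characters bound all open normal subgroups.\<close> If \<open>V \<noteq> G\<close> is open and normal, the quotient by \<open>V\<close>
  has a central subgroup \<open>W/V\<close> of prime order \<open>p\<close>, so \<open>V\<close> is the kernel of a conjugation invariant
  character \<open>W \<rightarrow> \<int>/p\<close> of the larger open normal subgroup \<open>W\<close>
  (\<open>open_normal_is_character_kernel\<close>). For fixed \<open>W\<close> there are countably many such
  characters (\<open>countable_invariant_characters\<close>): fixing coset representatives of \<open>W\<close>, two invariant
  characters that agree on the finitely many values of the resulting cocycle differ by the
  restriction of a character of \<open>G\<close>. This is the elementary content of the exact sequence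
  \<open>H\<^sup>1(G) \<rightarrow> H\<^sup>1(W)\<^sup>G \<rightarrow> H\<^sup>2(G/W)\<close> with coefficients in \<open>\<int>/p\<close>. Induction on the number of overgroups
  then counts all open normal subgroups.
\<close>

section \<open>Open subgroups of compact groups\<close>

lemma (in group) inv_cancel_left [simp]:
  assumes "x \<in> carrier G" "y \<in> carrier G"
  shows "x \<otimes> (inv x \<otimes> y) = y" "inv x \<otimes> (x \<otimes> y) = y"
  using assms by (simp_all flip: m_assoc)

lemma (in group) subgroup_subset_set_mult:
  assumes "subgroup H G" "subgroup K G"
  shows "H \<subseteq> H <#> K" "K \<subseteq> H <#> K"
proof -
  have "h \<otimes> \<one> \<in> H <#> K" if "h \<in> H" for h
    using that subgroup.one_closed [OF assms(2)] unfolding set_mult_def by blast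
  then show "H \<subseteq> H <#> K"
    using subgroup.mem_carrier [OF assms(1)] by auto
  have "\<one> \<otimes> k \<in> H <#> K" if "k \<in> K" for k
    using that subgroup.one_closed [OF assms(1)] unfolding set_mult_def by blast
  then show "K \<subseteq> H <#> K"
    using subgroup.mem_carrier [OF assms(2)] by auto
qed

context topological_group
begin

lemma open_right_translate:
  assumes "openin T U" "a \<in> carrier G"
  shows "openin T {x \<in> carrier G. x \<otimes> a \<in> U}"
proof -
  have "continuous_map T (prod_topology T T) (\<lambda>x. (x, a))"
    using assms by (simp add: continuous_map_pairedI topspace_eq_carrier)
  from continuous_map_compose [OF this continuous_mult]
  have "continuous_map T T (\<lambda>x. x \<otimes> a)"
    by (simp add: o_def)
  then show ?thesis
    using assms openin_continuous_map_preimage topspace_eq_carrier by force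
qed

lemma open_rcoset:
  assumes "openin T U" "a \<in> carrier G"
  shows "openin T (U #> a)"
proof -
  have U: "U \<subseteq> carrier G"
    using assms openin_subset topspace_eq_carrier by blast
  have "U #> a = {x \<in> carrier G. x \<otimes> inv a \<in> U}"
  proof
    show "U #> a \<subseteq> {x \<in> carrier G. x \<otimes> inv a \<in> U}"
      using U assms by (auto simp: r_coset_def m_assoc subset_iff)
    show "{x \<in> carrier G. x \<otimes> inv a \<in> U} \<subseteq> U #> a"
    proof
      fix x assume x: "x \<in> {x \<in> carrier G. x \<otimes> inv a \<in> U}"
      then have "x = (x \<otimes> inv a) \<otimes> a"
        using assms by (simp add: m_assoc)
      with x show "x \<in> U #> a"
        unfolding r_coset_def by blast
    qed
  qed
  then show ?thesis
    using open_right_translate [OF assms(1), of "inv a"] assms(2) by simp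
qed

lemma open_subgroupI:
  assumes H: "subgroup H G" and U: "openin T U" "\<one> \<in> U" "U \<subseteq> H"
  shows "openin T H"
proof (rule openin_subopen [THEN iffD2], rule ballI)
  fix h assume h: "h \<in> H"
  then have hc: "h \<in> carrier G"
    using subgroup.mem_carrier [OF H] by simp
  have "h \<in> U #> h"
    using U hc unfolding r_coset_def by force
  moreover have "U #> h \<subseteq> H"
    using U h subgroup.m_closed [OF H] by (auto simp: r_coset_def)
  ultimately show "\<exists>V. openin T V \<and> h \<in> V \<and> V \<subseteq> H"
    using open_rcoset [OF U(1) hc] by blast
qed

lemma open_subgroup_imp_closed:
  assumes H: "subgroup H G" "openin T H"
  shows "closedin T H"
proof -
  have "carrier G - H = \<Union> {H #> x | x. x \<in> carrier G - H}"
  proof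
    show "carrier G - H \<subseteq> \<Union> {H #> x | x. x \<in> carrier G - H}"
    proof
      fix x assume x: "x \<in> carrier G - H"
      then have "x \<in> H #> x" using rcos_self H by simp
      with x show "x \<in> \<Union> {H #> x | x. x \<in> carrier G - H}" by blast
    qed
    show "\<Union> {H #> x | x. x \<in> carrier G - H} \<subseteq> carrier G - H"
    proof clarify
      fix y x assume y: "y \<in> H #> x" and x: "x \<in> carrier G" "x \<notin> H"
      have "y \<in> carrier G"
        using subgroup.elemrcos_carrier [OF H(1) is_group x(1) y] .
      moreover have False if "y \<in> H"
      proof -
        have "H #> x = H"
          using repr_independence [OF y x(1) H(1)] subgroup.rcos_const [OF H(1) is_group that] by simp
        then show False
          using x H(1) coset_join1 by blast
      qed
      ultimately show "y \<in> carrier G - H" by blast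
    qed
  qed
  moreover have "openin T (\<Union> {H #> x | x. x \<in> carrier G - H})"
    using open_rcoset [OF H(2)] by (intro openin_Union) auto
  ultimately show ?thesis
    using H subgroup.subset topspace_eq_carrier unfolding closedin_def by metis
qed

end

locale compact_group = topological_group +
  assumes compact: "compact_space T"
begin

lemma finite_rcosets_open_subgroup:
  assumes H: "subgroup H G" "openin T H"
  shows "finite (rcosets H)"
proof -
  have op: "\<And>C. C \<in> rcosets H \<Longrightarrow> openin T C"
    using open_rcoset H by (auto simp: RCOSETS_def)
  have un: "\<Union> (rcosets H) = carrier G"
    using rcosets_part_G H by blast
  obtain F where F: "finite F" "F \<subseteq> rcosets H" "topspace T \<subseteq> \<Union> F"
    using compact op un topspace_eq_carrier
    unfolding compact_space_alt by (metis order_refl)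
  have "C \<in> F" if C: "C \<in> rcosets H" for C
  proof -
    obtain x where x: "x \<in> carrier G" "C = H #> x"
      using C by (auto simp: RCOSETS_def)
    then obtain B where B: "B \<in> F" "x \<in> B"
      using F(3) topspace_eq_carrier by blast
    then have "B = C"
      using F(2) C x rcos_self [OF x(1) H(1)] rcos_disjoint [OF H(1)]
      by (metis disjnt_iff pairwiseD subsetD)
    with B show ?thesis by simp
  qed
  then show ?thesis
    using finite_subset [OF _ F(1)] by blast
qed

text \<open>
  Finite index is what matters: an overgroup of \<open>U\<close> is a union of some of the finitely many cosets
  of \<open>U\<close>.
\<close>
lemma finite_overgroups:
  assumes U: "subgroup U G" "openin T U"
  shows "finite {H. subgroup H G \<and> U \<subseteq> H}"
proof (rule finite_subset)
  show "finite (Union ` Pow (rcosets U))"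
    using finite_rcosets_open_subgroup [OF U] by simp
  show "{H. subgroup H G \<and> U \<subseteq> H} \<subseteq> Union ` Pow (rcosets U)"
  proof clarify
    fix H assume H: "subgroup H G" "U \<subseteq> H"
    have "H = \<Union> {U #> h | h. h \<in> H}"
    proof
      show "H \<subseteq> \<Union> {U #> h | h. h \<in> H}"
      proof
        fix h assume h: "h \<in> H"
        then have "h \<in> U #> h" using rcos_self [OF _ U(1)] subgroup.mem_carrier [OF H(1)] by simp
        with h show "h \<in> \<Union> {U #> h | h. h \<in> H}" by blast
      qed
      show "\<Union> {U #> h | h. h \<in> H} \<subseteq> H"
        using H subgroup.m_closed [OF H(1)] by (auto simp: r_coset_def)
    qed
    moreover have "{U #> h | h. h \<in> H} \<in> Pow (rcosets U)"
      using subgroup.mem_carrier [OF H(1)] by (auto simp: RCOSETS_def)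
    ultimately show "H \<in> Union ` Pow (rcosets U)"
      by blast
  qed
qed

text \<open>
  The intersection is taken inside the group, so that the empty family yields the whole carrier
  rather than the universe of the type.
\<close>
definition Meet :: "'a set set \<Rightarrow> 'a set"
  where "Meet \<B> = carrier G \<inter> \<Inter> \<B>"

lemma subgroup_meet:
  assumes "\<And>M. M \<in> \<B> \<Longrightarrow> subgroup M G"
  shows "subgroup (Meet \<B>) G"
proof -
  have "subgroup (\<Inter> (insert (carrier G) \<B>)) G"
    using assms subgroup_self by (intro subgroups_Inter) auto
  then show ?thesis
    by (simp add: Meet_def)
qed

lemma open_meet:
  assumes "finite \<B>" "\<And>M. M \<in> \<B> \<Longrightarrow> openin T M"
  shows "openin T (Meet \<B>)"
proof -
  have "openin T (\<Inter> (insert (topspace T) \<B>))"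
    using assms by (intro openin_Inter) auto
  then show ?thesis
    by (simp add: Meet_def topspace_eq_carrier)
qed

text \<open>
  Compactness in the form used throughout: the closed sets \<open>M \<in> \<B>\<close> have no common point in the
  complement of \<open>U\<close>, so finitely many of them have none.
\<close>
lemma finite_submeet:
  assumes cl: "\<And>M. M \<in> \<B> \<Longrightarrow> closedin T M" and U: "openin T U" "Meet \<B> \<subseteq> U"
  obtains \<F> where "finite \<F>" "\<F> \<subseteq> \<B>" "Meet \<F> \<subseteq> U"
proof -
  let ?C = "insert (topspace T - U) \<B>"
  have "\<forall>C\<in>?C. closedin T C"
    using cl U(1) by auto
  moreover have "\<Inter> ?C = {}"
    using U(2) by (auto simp: Meet_def topspace_eq_carrier)
  ultimately obtain \<E> where \<E>: "finite \<E>" "\<E> \<subseteq> ?C" "\<Inter> \<E> = {}"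
    using compact [unfolded compact_space_fip, rule_format, of ?C] by blast
  let ?F = "\<E> - {topspace T - U}"
  have "Meet ?F \<subseteq> U"
  proof
    fix x assume x: "x \<in> Meet ?F"
    show "x \<in> U"
    proof (rule ccontr)
      assume "x \<notin> U"
      then have "x \<in> \<Inter> \<E>"
        using x by (auto simp: Meet_def topspace_eq_carrier)
      then show False using \<E>(3) by simp
    qed
  qed
  then show ?thesis
    using that [of ?F] \<E> by blast
qed

end

section \<open>Maximal open normal subgroups and independent families\<close>

context compact_group
begin

definition maximal_open_normal :: "'a set set"
  where "maximal_open_normal = {M. M \<lhd> G \<and> openin T M \<and> M \<noteq> carrier G \<and>
    (\<forall>H. subgroup H G \<longrightarrow> M \<subseteq> H \<longrightarrow> H = M \<or> H = carrier G)}"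

lemma maximal_open_normalD:
  assumes "M \<in> maximal_open_normal"
  shows "M \<lhd> G" "subgroup M G" "openin T M" "closedin T M" "M \<noteq> carrier G"
  using assms open_subgroup_imp_closed normal_imp_subgroup
  by (auto simp: maximal_open_normal_def)

text \<open>
  The product \<open>M <#> H\<close> is a subgroup because \<open>M\<close> is normal, and it is strictly larger than \<open>M\<close>.
  Factoring elements through it replaces linear algebra in the elementary abelian quotients of \<open>G\<close>.
\<close>
lemma maximal_open_normal_factor:
  assumes M: "M \<in> maximal_open_normal" and H: "subgroup H G" "\<not> H \<subseteq> M" and y: "y \<in> carrier G"
  obtains m h where "m \<in> M" "h \<in> H" "y = m \<otimes> h"
proof -
  note M' = maximal_open_normalD [OF M]
  have sub: "subgroup (M <#> H) G"
    using mult_norm_subgroup [OF M'(1) H(1)] .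
  have "M <#> H = carrier G"
    using M sub H(2) subgroup_subset_set_mult [OF M'(2) H(1)]
    unfolding maximal_open_normal_def by blast
  with y that show ?thesis
    unfolding set_mult_def by blast
qed

text \<open>
  The intersection of all other members is used here, not only that of finitely many of them. Since
  the members are clopen, compactness makes the two versions equivalent, and this one
  directly supplies an element separating \<open>M\<close> from the rest of the family.
\<close>
definition independent :: "'a set set \<Rightarrow> bool"
  where "independent \<B> \<longleftrightarrow> \<B> \<subseteq> maximal_open_normal \<and>
    (\<forall>M\<in>\<B>. \<not> Meet (\<B> - {M}) \<subseteq> M)"

lemma independent_separator:
  assumes "independent \<B>" "M \<in> \<B>"
  obtains g where "g \<in> Meet (\<B> - {M})" "g \<notin> M"
  using assms unfolding independent_def by blast

text \<open>
  For the kernels of the coordinates of a power of \<open>\<int>/p\<close> this is the direct sum.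
\<close>
definition cofinite_subgroup :: "'a set set \<Rightarrow> 'a set"
  where "cofinite_subgroup \<B> = {g \<in> carrier G. finite {M \<in> \<B>. g \<notin> M}}"

lemma subgroup_cofinite_subgroup:
  assumes "\<And>M. M \<in> \<B> \<Longrightarrow> subgroup M G"
  shows "subgroup (cofinite_subgroup \<B>) G"
proof
  show "cofinite_subgroup \<B> \<subseteq> carrier G"
    by (auto simp: cofinite_subgroup_def)
  have "{M \<in> \<B>. \<one> \<notin> M} = {}"
    using subgroup.one_closed [OF assms] by blast
  then show "\<one> \<in> cofinite_subgroup \<B>"
    by (simp only: cofinite_subgroup_def mem_Collect_eq one_closed finite.emptyI simp_thms)
next
  fix x y assume xy: "x \<in> cofinite_subgroup \<B>" "y \<in> cofinite_subgroup \<B>"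
  have "{M \<in> \<B>. x \<otimes> y \<notin> M} \<subseteq> {M \<in> \<B>. x \<notin> M} \<union> {M \<in> \<B>. y \<notin> M}"
    using subgroup.m_closed [OF assms] by blast
  moreover have "finite ({M \<in> \<B>. x \<notin> M} \<union> {M \<in> \<B>. y \<notin> M})"
    using xy by (simp add: cofinite_subgroup_def)
  ultimately show "x \<otimes> y \<in> cofinite_subgroup \<B>"
    using xy by (simp add: cofinite_subgroup_def finite_subset)
next
  fix x assume x: "x \<in> cofinite_subgroup \<B>"
  have "{M \<in> \<B>. inv x \<notin> M} \<subseteq> {M \<in> \<B>. x \<notin> M}"
    using subgroup.m_inv_closed [OF assms] by blast
  then show "inv x \<in> cofinite_subgroup \<B>"
    using x by (simp add: cofinite_subgroup_def finite_subset)
qed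

lemma meet_remove_subset_cofinite:
  assumes "M \<in> \<B>"
  shows "Meet (\<B> - {M}) \<subseteq> cofinite_subgroup \<B>"
proof
  fix g assume g: "g \<in> Meet (\<B> - {M})"
  then have "{N \<in> \<B>. g \<notin> N} \<subseteq> {M}"
    by (auto simp: Meet_def)
  then have "finite {N \<in> \<B>. g \<notin> N}"
    by (rule finite_subset) simp
  with g show "g \<in> cofinite_subgroup \<B>"
    by (simp add: Meet_def cofinite_subgroup_def)
qed

text \<open>
  If \<open>D \<subseteq> M'\<close> for the cofinite subgroup \<open>D\<close>, then \<open>\<Inter>\<B> \<subseteq> M'\<close>, and compactness gives a finite
  \<open>\<F> \<subseteq> \<B>\<close> with \<open>\<Inter>\<F> \<subseteq> M'\<close>. The members of \<open>\<F>\<close> can be discarded one at a time, until the empty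
  intersection \<open>G\<close> is contained in \<open>M'\<close>: the element of \<open>D\<close> that is outside \<open>M\<close> but in all other
  members belongs to \<open>M'\<close>, so \<open>\<Inter>\<F> \<inter> M'\<close> together with \<open>M\<close> generates \<open>G\<close>.
\<close>
lemma cofinite_subgroup_not_contained:
  assumes ind: "independent \<B>" and M': "M' \<in> maximal_open_normal"
  shows "\<not> cofinite_subgroup \<B> \<subseteq> M'"
proof
  assume D: "cofinite_subgroup \<B> \<subseteq> M'"
  note M'D = maximal_open_normalD [OF M']
  have Max: "M \<in> maximal_open_normal" if "M \<in> \<B>" for M
    using ind that by (auto simp: independent_def)
  have "Meet \<B> \<subseteq> cofinite_subgroup \<B>"
  proof
    fix g assume g: "g \<in> Meet \<B>"
    then have "{N \<in> \<B>. g \<notin> N} = {}"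
      by (auto simp: Meet_def)
    with g show "g \<in> cofinite_subgroup \<B>"
      unfolding cofinite_subgroup_def Meet_def by (metis (no_types, lifting) Int_iff finite.emptyI mem_Collect_eq)
  qed
  then have "Meet \<B> \<subseteq> M'"
    using D by simp
  then obtain \<F> where \<F>: "finite \<F>" "\<F> \<subseteq> \<B>" "Meet \<F> \<subseteq> M'"
    using finite_submeet [of \<B> M'] Max maximal_open_normalD M'D(3) by metis
  from \<F> show False
  proof (induction \<F>)
    case empty
    then show False
      using M'D(5) subgroup.subset [OF M'D(2)] by (auto simp: Meet_def)
  next
    case (insert M \<F>)
    have M: "M \<in> \<B>" and FB: "\<F> \<subseteq> \<B>"
      using insert.prems by auto
    obtain g where g: "g \<in> Meet (\<B> - {M})" "g \<notin> M"
      using independent_separator [OF ind M] .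
    have gM': "g \<in> M'"
      using g(1) meet_remove_subset_cofinite [OF M] D by blast
    have gF: "g \<in> Meet \<F>"
      using g(1) FB insert.hyps(2) by (auto simp: Meet_def)
    have sF: "subgroup (Meet \<F>) G"
      using FB Max maximal_open_normalD by (intro subgroup_meet) blast
    have sH: "subgroup (Meet \<F> \<inter> M') G"
      using sF M'D(2) subgroups_Inter_pair by blast
    have "Meet \<F> \<subseteq> M'"
    proof
      fix x assume x: "x \<in> Meet \<F>"
      have "\<not> Meet \<F> \<inter> M' \<subseteq> M"
        using g gF gM' by blast
      then obtain m h where mh: "m \<in> M" "h \<in> Meet \<F> \<inter> M'" "x = m \<otimes> h"
        using maximal_open_normal_factor [OF Max [OF M] sH] x by (auto simp: Meet_def)
      have hc: "h \<in> carrier G" "m \<in> carrier G"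
        using mh subgroup.mem_carrier [OF sH] subgroup.mem_carrier [OF maximal_open_normalD(2) [OF Max [OF M]]] by blast+
      have "m = x \<otimes> inv h"
        using mh(3) hc by (simp add: m_assoc)
      then have "m \<in> Meet \<F>"
        using x mh(2) subgroup.m_closed [OF sF] subgroup.m_inv_closed [OF sF] by simp
      then have "m \<in> Meet (insert M \<F>)"
        using mh(1) by (simp add: Meet_def)
      then show "x \<in> M'"
        using insert.prems(2) mh subgroup.m_closed [OF M'D(2)] by blast
    qed
    then show False
      using insert.IH FB by blast
  qed
qed

text \<open>
  Countably many elements of the subgroup avoid only countably many members of \<open>\<B>\<close>, so they share a
  common member \<open>M\<close>, which is closed. Their closure is trapped in \<open>M\<close>.
\<close>
lemma cofinite_subgroup_not_separable:
  assumes ind: "independent \<B>" and unc: "uncountable \<B>"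
  shows "\<not> separable_space (subtopology T (cofinite_subgroup \<B>))"
proof
  let ?D = "cofinite_subgroup \<B>"
  assume "separable_space (subtopology T ?D)"
  then obtain C where C: "countable C" "C \<subseteq> topspace (subtopology T ?D)"
    "subtopology T ?D closure_of C = topspace (subtopology T ?D)"
    unfolding separable_space_def by blast
  have top: "topspace (subtopology T ?D) = ?D"
    by (auto simp: cofinite_subgroup_def topspace_eq_carrier)
  have "countable (\<Union>c\<in>C. {M \<in> \<B>. c \<notin> M})"
  proof (rule countable_UN [OF C(1)])
    fix c assume "c \<in> C"
    then have "c \<in> ?D" using C(2) top by blast
    then show "countable {M \<in> \<B>. c \<notin> M}"
      by (simp add: cofinite_subgroup_def countable_finite)
  qed
  then obtain M where M: "M \<in> \<B>" "M \<notin> (\<Union>c\<in>C. {M \<in> \<B>. c \<notin> M})"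
    using unc by (metis (no_types, lifting) countable_subset subsetI)
  then have "C \<subseteq> M"
    by blast
  moreover have "closedin T M"
    using M ind maximal_open_normalD by (auto simp: independent_def)
  ultimately have "T closure_of C \<subseteq> M"
    by (simp add: closure_of_minimal)
  moreover have "?D \<inter> C = C"
    using C(2) top by blast
  then have "?D \<subseteq> T closure_of C"
    using C(3) top closure_of_subtopology [of T ?D C] by auto
  ultimately have "?D \<subseteq> M"
    by blast
  moreover obtain g where "g \<in> Meet (\<B> - {M})" "g \<notin> M"
    using independent_separator [OF ind M(1)] .
  ultimately show False
    using meet_remove_subset_cofinite [OF M(1)] by blast
qed

text \<open>
  Zorn's lemma applies because independence has finite character: a failure of independence in the
  union of a chain is witnessed, by compactness, by finitely many members.
\<close>
lemma ex_maximal_independent: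
  obtains \<B> where "independent \<B>" "\<And>\<C>. independent \<C> \<Longrightarrow> \<B> \<subseteq> \<C> \<Longrightarrow> \<C> = \<B>"
proof -
  have "\<exists>\<B>\<in>Collect independent. \<forall>\<C>\<in>Collect independent. \<B> \<subseteq> \<C> \<longrightarrow> \<C> = \<B>"
  proof (rule subset_Zorn')
    fix \<K> assume ch: "subset.chain (Collect independent) \<K>"
    then have ind: "\<And>\<B>. \<B> \<in> \<K> \<Longrightarrow> independent \<B>"
      by (auto simp: subset.chain_def)
    have Max: "\<Union> \<K> \<subseteq> maximal_open_normal"
      using ind by (auto simp: independent_def)
    have "\<not> Meet (\<Union> \<K> - {M}) \<subseteq> M" if M: "M \<in> \<Union> \<K>" for M
    proof
      assume "Meet (\<Union> \<K> - {M}) \<subseteq> M"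
      moreover have "\<And>N. N \<in> \<Union> \<K> - {M} \<Longrightarrow> closedin T N"
        using Max maximal_open_normalD by blast
      moreover have "openin T M"
        using M Max maximal_open_normalD by blast
      ultimately obtain \<F> where \<F>: "finite \<F>" "\<F> \<subseteq> \<Union> \<K> - {M}" "Meet \<F> \<subseteq> M"
        using finite_submeet by metis
      have "finite (insert M \<F>)" "insert M \<F> \<subseteq> \<Union> \<K>" "\<K> \<noteq> {}"
        using \<F> M by auto
      then obtain \<B> where \<B>: "\<B> \<in> \<K>" "insert M \<F> \<subseteq> \<B>"
        using finite_subset_Union_chain ch by metis
      then have "Meet (\<B> - {M}) \<subseteq> M"
        using \<F> by (auto simp: Meet_def)
      then show False
        using ind [OF \<B>(1)] \<B>(2) by (auto simp: independent_def)
    qed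
    then show "\<Union> \<K> \<in> Collect independent"
      using Max by (auto simp: independent_def)
  qed
  with that show ?thesis by blast
qed

text \<open>
  An exchange argument. If \<open>M'\<close> cannot be added to \<open>\<B>\<close>, then either the intersection of \<open>\<B>\<close> lies in
  \<open>M'\<close>, or some \<open>M \<in> \<B>\<close> contains \<open>M' \<inter> A\<close>, where \<open>A\<close> is the intersection of the other members. In the
  second case, factor an element \<open>g \<in> A\<close> outside \<open>M\<close> as \<open>m \<otimes> h\<close> with \<open>m \<in> M'\<close> and \<open>h\<close> in the
  intersection of \<open>\<B>\<close>; both factors then lie in \<open>M\<close>.
\<close>
lemma maximal_independent_meet:
  assumes ind: "independent \<B>" and max: "\<And>\<C>. independent \<C> \<Longrightarrow> \<B> \<subseteq> \<C> \<Longrightarrow> \<C> = \<B>"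
    and M': "M' \<in> maximal_open_normal"
  shows "Meet \<B> \<subseteq> M'"
proof (rule ccontr)
  assume nsub: "\<not> Meet \<B> \<subseteq> M'"
  have Max: "M \<in> maximal_open_normal" if "M \<in> \<B>" for M
    using ind that by (auto simp: independent_def)
  have "M' \<notin> \<B>"
    using nsub by (auto simp: Meet_def)
  then have "\<not> independent (insert M' \<B>)"
    using max by blast
  then obtain M where M: "M \<in> insert M' \<B>" "Meet (insert M' \<B> - {M}) \<subseteq> M"
    using ind M' unfolding independent_def by blast
  have "M \<noteq> M'"
    using M(2) nsub \<open>M' \<notin> \<B>\<close> by auto
  with M have MB: "M \<in> \<B>" by blast
  have eq: "Meet (insert M' \<B> - {M}) = M' \<inter> Meet (\<B> - {M})"
    using \<open>M \<noteq> M'\<close> by (auto simp: Meet_def)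
  obtain g where g: "g \<in> Meet (\<B> - {M})" "g \<notin> M"
    using independent_separator [OF ind MB] .
  have sB: "subgroup (Meet \<B>) G" and sB': "subgroup (Meet (\<B> - {M})) G"
    using Max maximal_open_normalD(2) by (auto intro!: subgroup_meet)
  have "g \<in> carrier G"
    using g by (auto simp: Meet_def)
  then obtain m h where mh: "m \<in> M'" "h \<in> Meet \<B>" "g = m \<otimes> h"
    using maximal_open_normal_factor [OF M' sB nsub] by metis
  have c: "m \<in> carrier G" "h \<in> carrier G"
    using mh subgroup.mem_carrier [OF sB] subgroup.mem_carrier [OF maximal_open_normalD(2) [OF M']] by blast+
  have h: "h \<in> Meet (\<B> - {M})" "h \<in> M"
    using mh(2) MB by (auto simp: Meet_def)
  have "m = g \<otimes> inv h"
    using mh(3) c by (simp add: m_assoc)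
  then have "m \<in> Meet (\<B> - {M})"
    using g(1) h(1) subgroup.m_closed [OF sB'] subgroup.m_inv_closed [OF sB'] by simp
  then have "m \<in> M"
    using mh(1) M(2) eq by blast
  then show False
    using g(2) mh(3) h(2) subgroup.m_closed [OF maximal_open_normalD(2) [OF Max [OF MB]]] by blast
qed

text \<open>
  A maximal independent family has countably many finite subfamilies, each maximal open normal
  subgroup contains the intersection of one of them, and such an intersection is an open subgroup,
  hence has finitely many overgroups.
\<close>
lemma countable_maximal_open_normal:
  assumes "\<And>\<B>. independent \<B> \<Longrightarrow> countable \<B>"
  shows "countable maximal_open_normal"
proof -
  obtain \<B> where ind: "independent \<B>" and max: "\<And>\<C>. independent \<C> \<Longrightarrow> \<B> \<subseteq> \<C> \<Longrightarrow> \<C> = \<B>"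
    using ex_maximal_independent by metis
  let ?Fin = "{\<F>. finite \<F> \<and> \<F> \<subseteq> \<B>}"
  have Max: "M \<in> maximal_open_normal" if "M \<in> \<B>" for M
    using ind that by (auto simp: independent_def)
  have "maximal_open_normal \<subseteq> (\<Union>\<F>\<in>?Fin. {H. subgroup H G \<and> Meet \<F> \<subseteq> H})"
  proof
    fix M' assume M': "M' \<in> maximal_open_normal"
    obtain \<F> where "finite \<F>" "\<F> \<subseteq> \<B>" "Meet \<F> \<subseteq> M'"
      using finite_submeet [of \<B> M'] Max maximal_open_normalD maximal_independent_meet [OF ind max M'] M'
      by metis
    then show "M' \<in> (\<Union>\<F>\<in>?Fin. {H. subgroup H G \<and> Meet \<F> \<subseteq> H})"
      using maximal_open_normalD(2) [OF M'] by blast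
  qed
  moreover have "countable (\<Union>\<F>\<in>?Fin. {H. subgroup H G \<and> Meet \<F> \<subseteq> H})"
  proof (rule countable_UN)
    show "countable ?Fin"
      using assms [OF ind] countable_Collect_finite_subset by blast
    fix \<F> assume "\<F> \<in> ?Fin"
    then have F: "finite \<F>" "\<And>M. M \<in> \<F> \<Longrightarrow> subgroup M G" "\<And>M. M \<in> \<F> \<Longrightarrow> openin T M"
      using Max maximal_open_normalD by auto
    show "countable {H. subgroup H G \<and> Meet \<F> \<subseteq> H}"
      using finite_overgroups [OF subgroup_meet [OF F(2)] open_meet [OF F(1,3)]]
      by (simp add: countable_finite)
  qed
  ultimately show ?thesis
    using countable_subset by blast
qed

end

section \<open>Residual nilpotency and density\<close>

lemma (in group) lower_central_series_subset_carrier: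
  "lower_central_series G n \<subseteq> carrier G"
proof (induction n)
  case (Suc n)
  then have "(\<Union>x \<in> lower_central_series G n. \<Union>y \<in> carrier G. {x \<otimes> y \<otimes> inv x \<otimes> inv y}) \<subseteq> carrier G"
    by auto
  then show ?case
    using generate_incl by simp
qed simp

lemma (in group) commutator_in_lower_central_series:
  assumes "x \<in> lower_central_series G n" "y \<in> carrier G"
  shows "x \<otimes> y \<otimes> inv x \<otimes> inv y \<in> lower_central_series G (Suc n)"
  using assms by (auto intro!: generate.incl)

locale compact_residually_nilpotent_group = compact_group +
  assumes small_open_normal: "\<lbrakk>openin T U; \<one> \<in> U\<rbrakk> \<Longrightarrow>
    \<exists>N n. N \<lhd> G \<and> openin T N \<and> N \<subseteq> U \<and> lower_central_series G n \<subseteq> N"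
begin

text \<open>
  Take the first term of the lower central series that lies in \<open>V\<close>, and an element outside \<open>V\<close> of the
  term before it. One application is to maximal open subgroups, in order to prove them normal.
\<close>
lemma ex_central_modulo:
  assumes V: "subgroup V G" "openin T V" "V \<noteq> carrier G"
  obtains u where "u \<in> carrier G" "u \<notin> V"
    "\<And>g. g \<in> carrier G \<Longrightarrow> u \<otimes> g \<otimes> inv u \<otimes> inv g \<in> V"
proof -
  define n where "n = (LEAST n. lower_central_series G n \<subseteq> V)"
  have "\<exists>n. lower_central_series G n \<subseteq> V"
    using small_open_normal [OF V(2) subgroup.one_closed [OF V(1)]] by blast
  then have n: "lower_central_series G n \<subseteq> V"
    unfolding n_def by (rule LeastI_ex)
  have "n \<noteq> 0"
  proof
    assume "n = 0"
    with n show False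
      using V(3) subgroup.subset [OF V(1)] by simp
  qed
  then obtain k where k: "n = Suc k"
    using not0_implies_Suc by blast
  have "\<not> lower_central_series G k \<subseteq> V"
    using not_less_Least [of k "\<lambda>n. lower_central_series G n \<subseteq> V"] k n_def by simp
  then obtain u where u: "u \<in> lower_central_series G k" "u \<notin> V"
    by blast
  show ?thesis
  proof (rule that [OF _ u(2)])
    show "u \<in> carrier G"
      using u(1) lower_central_series_subset_carrier by blast
    show "u \<otimes> g \<otimes> inv u \<otimes> inv g \<in> V" if "g \<in> carrier G" for g
      using commutator_in_lower_central_series [OF u(1) that] n k by blast
  qed
qed

text \<open>
  The analogue of the fact that proper subgroups of nilpotent groups grow in their normalizers: an
  element \<open>u\<close> outside \<open>M\<close> whose commutators all lie in \<open>M\<close> normalizes \<open>M\<close>.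
\<close>
lemma maximal_open_subgroup_normal:
  assumes M: "subgroup M G" "openin T M" "M \<noteq> carrier G"
    and max: "\<And>H. subgroup H G \<Longrightarrow> M \<subseteq> H \<Longrightarrow> H = M \<or> H = carrier G"
  shows "M \<lhd> G"
proof -
  obtain u where u: "u \<in> carrier G" "u \<notin> M"
    "\<And>g. g \<in> carrier G \<Longrightarrow> u \<otimes> g \<otimes> inv u \<otimes> inv g \<in> M"
    using ex_central_modulo [OF M] by blast
  let ?N = "{y \<in> carrier G. \<forall>m\<in>M. y \<otimes> m \<otimes> inv y \<in> M \<and> inv y \<otimes> m \<otimes> y \<in> M}"
  note Mc = subgroup.mem_carrier [OF M(1)]
  note Mm = subgroup.m_closed [OF M(1)]
  note Mi = subgroup.m_inv_closed [OF M(1)]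
  have N: "subgroup ?N G"
  proof
    show "?N \<subseteq> carrier G" by blast
    show "\<one> \<in> ?N" using Mc by simp
    show "inv y \<in> ?N" if "y \<in> ?N" for y
      using that by simp
    fix x y assume xy: "x \<in> ?N" "y \<in> ?N"
    have "x \<otimes> y \<otimes> m \<otimes> inv (x \<otimes> y) = x \<otimes> (y \<otimes> m \<otimes> inv y) \<otimes> inv x"
      "inv (x \<otimes> y) \<otimes> m \<otimes> (x \<otimes> y) = inv y \<otimes> (inv x \<otimes> m \<otimes> x) \<otimes> y" if "m \<in> M" for m
      using xy Mc [OF that] by (simp_all add: m_assoc inv_mult_group)
    with xy show "x \<otimes> y \<in> ?N" by simp
  qed
  have "M \<subseteq> ?N"
    using Mc Mm Mi by auto
  moreover have "u \<in> ?N"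
  proof -
    have "u \<otimes> m \<otimes> inv u \<in> M \<and> inv u \<otimes> m \<otimes> u \<in> M" if m: "m \<in> M" for m
    proof
      have mc: "m \<in> carrier G" using Mc m .
      have "u \<otimes> m \<otimes> inv u = (u \<otimes> m \<otimes> inv u \<otimes> inv m) \<otimes> m"
        using u(1) mc by (simp add: m_assoc)
      then show "u \<otimes> m \<otimes> inv u \<in> M"
        using Mm [OF u(3) [OF mc] m] by metis
      \<comment> \<open>The commutator of \<open>u\<close> with \<open>inv u \<otimes> m \<otimes> u\<close> is \<open>m\<close> times the inverse of that conjugate.\<close>
      let ?g = "inv u \<otimes> m \<otimes> u"
      have "?g = inv (u \<otimes> ?g \<otimes> inv u \<otimes> inv ?g) \<otimes> m"
        using u(1) mc by (simp add: m_assoc inv_mult_group)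
      moreover have "?g \<in> carrier G"
        using u(1) mc by simp
      ultimately show "?g \<in> M"
        using Mm [OF Mi [OF u(3)] m] by metis
    qed
    with u(1) show ?thesis by blast
  qed
  ultimately have "?N = carrier G"
    using max [OF N] u(2) by blast
  then have "x \<otimes> m \<otimes> inv x \<in> M" if "x \<in> carrier G" "m \<in> M" for x m
    using that by blast
  then show ?thesis
    using normal_invI [OF M(1)] by blast
qed

lemma open_subgroup_in_maximal_open_normal:
  assumes U: "subgroup U G" "openin T U" "U \<noteq> carrier G"
  obtains M where "M \<in> maximal_open_normal" "U \<subseteq> M"
proof -
  define \<H> where "\<H> = {H. subgroup H G \<and> U \<subseteq> H \<and> H \<noteq> carrier G}"
  have "finite \<H>"
    unfolding \<H>_def by (rule finite_subset [OF _ finite_overgroups [OF U(1,2)]]) blast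
  moreover have "U \<in> \<H>"
    using U by (simp add: \<H>_def)
  ultimately obtain M where "M \<in> \<H>" and max\<H>: "\<forall>H\<in>\<H>. M \<subseteq> H \<longrightarrow> M = H"
    using finite_has_maximal2 [of \<H> U] by metis
  then have M: "subgroup M G" "U \<subseteq> M" "M \<noteq> carrier G"
    by (simp_all add: \<H>_def)
  have max: "H = M \<or> H = carrier G" if H: "subgroup H G" "M \<subseteq> H" for H
  proof (cases "H = carrier G")
    case False
    then have "H \<in> \<H>"
      using H M(2) by (simp add: \<H>_def)
    then show ?thesis
      using max\<H> H(2) by blast
  qed simp
  have "openin T M"
    using open_subgroupI [OF M(1) U(2) subgroup.one_closed [OF U(1)] M(2)] .
  then have "M \<in> maximal_open_normal"
    using maximal_open_subgroup_normal [OF M(1) _ M(3) max] M(3) max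
    unfolding maximal_open_normal_def by simp
  with M(2) that show ?thesis by simp
qed

text \<open>
  If the coset \<open>N #> x\<close> of an open normal subgroup \<open>N\<close> misses \<open>D\<close>, then \<open>N <#> D\<close> is a proper open
  subgroup and so lies in a maximal open normal subgroup, which cannot contain \<open>D\<close>.
\<close>
lemma cofinite_subgroup_dense:
  assumes ind: "independent \<B>"
  shows "T closure_of cofinite_subgroup \<B> = topspace T"
proof -
  let ?D = "cofinite_subgroup \<B>"
  have D: "subgroup ?D G"
    using ind maximal_open_normalD(2) by (intro subgroup_cofinite_subgroup) (auto simp: independent_def)
  have "\<exists>y. y \<in> ?D \<and> y \<in> Q" if x: "x \<in> topspace T" and Q: "x \<in> Q" "openin T Q" for x Q
  proof (rule ccontr)
    assume disj: "\<not> (\<exists>y. y \<in> ?D \<and> y \<in> Q)"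
    have xc: "x \<in> carrier G"
      using x topspace_eq_carrier by simp
    have "\<one> \<in> {y \<in> carrier G. y \<otimes> x \<in> Q}"
      using Q(1) xc by simp
    then obtain N where N: "N \<lhd> G" "openin T N" "N \<subseteq> {y \<in> carrier G. y \<otimes> x \<in> Q}"
      using small_open_normal [OF open_right_translate [OF Q(2) xc]] by blast
    have Ns: "subgroup N G"
      using N(1) normal_imp_subgroup by blast
    have ND: "subgroup (N <#> ?D) G"
      using mult_norm_subgroup [OF N(1) D] .
    have "openin T (N <#> ?D)"
      using open_subgroupI [OF ND N(2) subgroup.one_closed [OF Ns]]
        subgroup_subset_set_mult(1) [OF Ns D] by blast
    moreover have "N <#> ?D \<noteq> carrier G"
    proof
      assume "N <#> ?D = carrier G"
      then obtain m d where md: "m \<in> N" "d \<in> ?D" "x = m \<otimes> d"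
        using xc unfolding set_mult_def by blast
      have "d = inv m \<otimes> x"
        using md subgroup.mem_carrier [OF Ns] subgroup.mem_carrier [OF D] by simp
      then have "d \<in> Q"
        using N(3) subgroup.m_inv_closed [OF Ns md(1)] by blast
      then show False
        using disj md(2) by blast
    qed
    ultimately obtain M where M: "M \<in> maximal_open_normal" "N <#> ?D \<subseteq> M"
      using open_subgroup_in_maximal_open_normal [OF ND] by blast
    then show False
      using cofinite_subgroup_not_contained [OF ind M(1)] subgroup_subset_set_mult(2) [OF Ns D]
      by blast
  qed
  then show ?thesis
    unfolding closure_of_def by blast
qed

lemma countable_maximal_open_normal_if_dense_separable:
  assumes "\<And>D. subgroup D G \<Longrightarrow> T closure_of D = topspace T \<Longrightarrow> separable_space (subtopology T D)"
  shows "countable maximal_open_normal"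
proof (rule countable_maximal_open_normal)
  fix \<B> assume ind: "independent \<B>"
  then have "subgroup (cofinite_subgroup \<B>) G"
    using maximal_open_normalD(2) by (intro subgroup_cofinite_subgroup) (auto simp: independent_def)
  then show "countable \<B>"
    using assms cofinite_subgroup_dense [OF ind] cofinite_subgroup_not_separable [OF ind] by blast
qed

end

section \<open>Characters modulo a prime\<close>

context compact_group
begin

text \<open>
  The continuous homomorphisms from \<open>W\<close> to \<open>\<int>/p\<close> that are invariant under conjugation by \<open>G\<close>, with
  residues represented in \<open>{0..<p}\<close>. Values outside \<open>W\<close> are fixed by extensionality, so that counting
  these functions counts the homomorphisms.
\<close>
definition invariant_characters :: "'a set \<Rightarrow> nat \<Rightarrow> ('a \<Rightarrow> int) set"
  where "invariant_characters W p = {\<rho> \<in> W \<rightarrow>\<^sub>E {0..<int p}.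
    (\<forall>x\<in>W. \<forall>y\<in>W. \<rho> (x \<otimes> y) = (\<rho> x + \<rho> y) mod int p) \<and>
    (\<forall>g\<in>carrier G. \<forall>x\<in>W. \<rho> (g \<otimes> x \<otimes> inv g) = \<rho> x) \<and>
    openin T {x \<in> W. \<rho> x = 0}}"

lemma invariant_charactersD:
  assumes "\<rho> \<in> invariant_characters W p"
  shows "\<rho> \<in> extensional W"
    "x \<in> W \<Longrightarrow> 0 \<le> \<rho> x" "x \<in> W \<Longrightarrow> \<rho> x < int p" "x \<in> W \<Longrightarrow> \<rho> x mod int p = \<rho> x"
    "x \<in> W \<Longrightarrow> y \<in> W \<Longrightarrow> \<rho> (x \<otimes> y) = (\<rho> x + \<rho> y) mod int p"
    "g \<in> carrier G \<Longrightarrow> x \<in> W \<Longrightarrow> \<rho> (g \<otimes> x \<otimes> inv g) = \<rho> x"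
    "openin T {x \<in> W. \<rho> x = 0}"
  using assms by (auto simp: invariant_characters_def PiE_iff)

lemma character_one:
  assumes "\<rho> \<in> invariant_characters W p" "subgroup W G"
  shows "\<rho> \<one> = 0"
proof -
  note \<rho> = invariant_charactersD [OF assms(1)]
  have W: "\<one> \<in> W"
    using subgroup.one_closed assms(2) .
  have "(\<rho> \<one> + \<rho> \<one>) mod int p = \<rho> \<one> mod int p"
    using \<rho>(5) [OF W W] \<rho>(4) [OF W] by simp
  then have "int p dvd \<rho> \<one>"
    by (simp add: mod_eq_dvd_iff)
  then show ?thesis
    using \<rho>(4) [OF W] by simp
qed

lemma character_inv:
  assumes "\<rho> \<in> invariant_characters W p" "subgroup W G" "x \<in> W"
  shows "\<rho> (inv x) = (- \<rho> x) mod int p"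
proof -
  note \<rho> = invariant_charactersD [OF assms(1)]
  have W: "inv x \<in> W"
    using subgroup.m_inv_closed assms(2,3) .
  have "\<rho> (x \<otimes> inv x) = 0"
    using character_one [OF assms(1,2)] subgroup.mem_carrier [OF assms(2,3)] by simp
  then have "(\<rho> x + \<rho> (inv x)) mod int p = 0"
    using \<rho>(5) [OF assms(3) W] by simp
  then have "\<rho> (inv x) mod int p = (- \<rho> x) mod int p"
    by (simp add: mod_eq_dvd_iff add.commute mod_eq_0_iff_dvd)
  then show ?thesis
    using \<rho>(4) [OF W] by simp
qed

lemma character_pow:
  assumes "\<rho> \<in> invariant_characters W p" "subgroup W G" "x \<in> W"
  shows "\<rho> (x [^] (k::nat)) = (int k * \<rho> x) mod int p"
proof (induction k)
  case 0
  then show ?case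
    using character_one [OF assms(1,2)] by simp
next
  case (Suc k)
  have "x [^] k \<in> W"
    using assms(2,3) by (induction k) (simp_all add: subgroup.one_closed subgroup.m_closed)
  then have "\<rho> (x [^] Suc k) = (\<rho> (x [^] k) + \<rho> x) mod int p"
    using invariant_charactersD(5) [OF assms(1)] assms(3) by simp
  also have "\<dots> = (int (Suc k) * \<rho> x) mod int p"
    unfolding Suc by (simp add: algebra_simps mod_simps)
  finally show ?case .
qed

lemma character_kernel_normal:
  assumes "\<rho> \<in> invariant_characters W p" "W \<lhd> G"
  shows "{x \<in> W. \<rho> x = 0} \<lhd> G"
proof (rule normal_invI)
  note \<rho> = invariant_charactersD [OF assms(1)]
  have W: "subgroup W G"
    using assms(2) normal_imp_subgroup by blast
  show "subgroup {x \<in> W. \<rho> x = 0} G"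
  proof
    show "{x \<in> W. \<rho> x = 0} \<subseteq> carrier G"
      using subgroup.subset [OF W] by blast
    show "\<one> \<in> {x \<in> W. \<rho> x = 0}"
      using subgroup.one_closed [OF W] character_one [OF assms(1) W] by simp
    show "x \<otimes> y \<in> {x \<in> W. \<rho> x = 0}" if "x \<in> {x \<in> W. \<rho> x = 0}" "y \<in> {x \<in> W. \<rho> x = 0}" for x y
      using that \<rho>(5) [of x y] subgroup.m_closed [OF W] by simp
    show "inv x \<in> {x \<in> W. \<rho> x = 0}" if "x \<in> {x \<in> W. \<rho> x = 0}" for x
      using that character_inv [OF assms(1) W] subgroup.m_inv_closed [OF W] by simp
  qed
  show "g \<otimes> x \<otimes> inv g \<in> {x \<in> W. \<rho> x = 0}" if "g \<in> carrier G" "x \<in> {x \<in> W. \<rho> x = 0}" for g x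
    using that \<rho>(6) normal.inv_op_closed2 [OF assms(2)] by simp
qed

text \<open>
  A nonzero residue \<open>\<alpha> t\<close> generates \<open>\<int>/p\<close>, so every element of \<open>G\<close> is congruent to a power of \<open>t\<close>
  modulo the kernel of \<open>\<alpha>\<close>.
\<close>
lemma character_ex_pow:
  assumes \<alpha>: "\<alpha> \<in> invariant_characters (carrier G) p" and p: "prime p"
    and t: "t \<in> carrier G" "\<alpha> t \<noteq> 0" and y: "y \<in> carrier G"
  obtains k :: nat where "\<alpha> (y \<otimes> inv (t [^] k)) = 0"
proof -
  note \<alpha>' = invariant_charactersD [OF \<alpha>]
  have "\<not> int p dvd \<alpha> t"
    using \<alpha>'(2,3) [OF t(1)] t(2) zdvd_not_zless [of "\<alpha> t" "int p"] by simp
  then have "coprime (\<alpha> t) (int p)"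
    using p prime_imp_coprime [of "int p" "\<alpha> t"] by (simp add: coprime_commute)
  then obtain a where a: "[\<alpha> t * a = 1] (mod int p)"
    using cong_solve_coprime_int by blast
  define k where "k = nat ((a * \<alpha> y) mod int p)"
  have "int k = (a * \<alpha> y) mod int p"
    using prime_gt_0_nat [OF p] by (simp add: k_def)
  then have "[int k * \<alpha> t = (a * \<alpha> y) * \<alpha> t] (mod int p)"
    by (simp add: cong_def mod_simps)
  also have "(a * \<alpha> y) * \<alpha> t = (\<alpha> t * a) * \<alpha> y"
    by (simp add: ac_simps)
  also have "[(\<alpha> t * a) * \<alpha> y = 1 * \<alpha> y] (mod int p)"
    using a cong_scalar_right by blast
  finally have k: "(int k * \<alpha> t) mod int p = \<alpha> y mod int p"
    by (simp add: cong_def)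
  have "\<alpha> (y \<otimes> inv (t [^] k)) = (\<alpha> y + (- ((int k * \<alpha> t) mod int p)) mod int p) mod int p"
    using \<alpha>'(5) [of y "inv (t [^] k)"] character_inv [OF \<alpha> subgroup_self, of "t [^] k"]
      character_pow [OF \<alpha> subgroup_self t(1), of k] y t(1) by simp
  also have "\<dots> = 0"
    unfolding k by (simp add: mod_simps)
  finally show ?thesis
    using that by blast
qed

lemma character_kernel_maximal:
  assumes \<alpha>: "\<alpha> \<in> invariant_characters (carrier G) p" and p: "prime p"
    and t: "t \<in> carrier G" "\<alpha> t \<noteq> 0"
  shows "{x \<in> carrier G. \<alpha> x = 0} \<in> maximal_open_normal"
proof -
  let ?M = "{x \<in> carrier G. \<alpha> x = 0}"
  have N: "?M \<lhd> G"
    using character_kernel_normal [OF \<alpha>] normal_self by blast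
  have "openin T ?M"
    using invariant_charactersD(7) [OF \<alpha>] .
  moreover have "?M \<noteq> carrier G"
    using t by blast
  moreover have "H = ?M \<or> H = carrier G" if H: "subgroup H G" "?M \<subseteq> H" for H
  proof (cases "H = ?M")
    case False
    then obtain s where s: "s \<in> H" "s \<in> carrier G" "\<alpha> s \<noteq> 0"
      using H subgroup.subset [OF H(1)] by blast
    have "y \<in> H" if y: "y \<in> carrier G" for y
    proof -
      obtain k :: nat where k: "\<alpha> (y \<otimes> inv (s [^] k)) = 0"
        using character_ex_pow [OF \<alpha> p s(2,3) y] .
      then have "y \<otimes> inv (s [^] k) \<in> H"
        using H(2) y s(2) by auto
      moreover have "s [^] k \<in> H"
        using H(1) s(1) by (induction k) (simp_all add: subgroup.one_closed subgroup.m_closed)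
      ultimately have "y \<otimes> inv (s [^] k) \<otimes> s [^] k \<in> H"
        using subgroup.m_closed [OF H(1)] by blast
      then show ?thesis
        using y s(2) by (simp add: m_assoc)
    qed
    then show ?thesis
      using subgroup.subset [OF H(1)] by blast
  qed simp
  ultimately show ?thesis
    using N unfolding maximal_open_normal_def by blast
qed

text \<open>
  A nonzero character is determined by its kernel, a maximal open normal subgroup, and its value at
  one chosen element \<open>t\<close> outside the kernel, since the group is generated by \<open>t\<close> and the kernel.
\<close>
lemma countable_characters:
  assumes count: "countable maximal_open_normal" and p: "prime p"
  shows "countable (invariant_characters (carrier G) p)"
proof -
  \<comment> \<open>For \<open>M = carrier G\<close> the choice is arbitrary; that kernel belongs to the zero character only.\<close>
  define t where "t M = (SOME x. x \<in> carrier G - M)" for M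
  define K where "K \<alpha> = {x \<in> carrier G. \<alpha> x = 0}" for \<alpha> :: "'a \<Rightarrow> int"
  let ?X = "invariant_characters (carrier G) p"
  let ?f = "\<lambda>\<alpha>. (K \<alpha>, \<alpha> (t (K \<alpha>)))"
  have t: "t (K \<alpha>) \<in> carrier G \<and> \<alpha> (t (K \<alpha>)) \<noteq> 0" if "K \<alpha> \<noteq> carrier G" for \<alpha> :: "'a \<Rightarrow> int"
  proof -
    have "\<exists>x. x \<in> carrier G - K \<alpha>"
      using that by (auto simp: K_def)
    then have "t (K \<alpha>) \<in> carrier G - K \<alpha>"
      unfolding t_def by (rule someI_ex)
    then show ?thesis
      by (auto simp: K_def)
  qed
  have "inj_on ?f ?X"
  proof (rule inj_onI)
    fix \<alpha> \<beta> assume \<alpha>: "\<alpha> \<in> ?X" and \<beta>: "\<beta> \<in> ?X" and eq: "?f \<alpha> = ?f \<beta>"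
    have "\<alpha> y = \<beta> y" if y: "y \<in> carrier G" for y
    proof (cases "K \<alpha> = carrier G")
      case True
      then have "y \<in> K \<alpha>" "y \<in> K \<beta>"
        using y eq by simp_all
      then show ?thesis
        by (simp add: K_def)
    next
      case False
      define s where "s = t (K \<alpha>)"
      have s: "s \<in> carrier G" "\<alpha> s \<noteq> 0" "\<beta> s = \<alpha> s"
        using t [OF False] eq by (auto simp: s_def)
      obtain k :: nat where k: "\<alpha> (y \<otimes> inv (s [^] k)) = 0"
        using character_ex_pow [OF \<alpha> p s(1,2) y] .
      let ?m = "y \<otimes> inv (s [^] k)"
      have m: "?m \<in> carrier G" "?m \<in> K \<alpha>"
        using y s(1) k by (simp_all add: K_def)
      then have "?m \<in> K \<beta>"
        using eq by simp
      then have k': "\<beta> ?m = 0"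
        by (simp add: K_def)
      have ym: "y = ?m \<otimes> s [^] k"
        using y s(1) by (simp add: m_assoc)
      have val: "\<phi> y = (\<phi> ?m + (int k * \<phi> s) mod int p) mod int p" if "\<phi> \<in> ?X" for \<phi>
        using invariant_charactersD(5) [OF that m(1), of "s [^] k"] ym
          character_pow [OF that subgroup_self s(1), of k] s(1) by simp
      then show ?thesis
        using val [OF \<alpha>] val [OF \<beta>] k k' s(3) by simp
    qed
    then show "\<alpha> = \<beta>"
      using invariant_charactersD(1) [OF \<alpha>] invariant_charactersD(1) [OF \<beta>] by (blast intro: extensionalityI)
  qed
  moreover have "?f ` ?X \<subseteq> insert (carrier G) maximal_open_normal \<times> UNIV"
  proof
    fix q assume "q \<in> ?f ` ?X"
    then obtain \<alpha> where \<alpha>: "\<alpha> \<in> ?X" "q = ?f \<alpha>"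
      by blast
    have "K \<alpha> \<in> insert (carrier G) maximal_open_normal"
    proof (cases "K \<alpha> = carrier G")
      case False
      then show ?thesis
        using character_kernel_maximal [OF \<alpha>(1) p] t [OF False] by (auto simp: K_def)
    qed simp
    with \<alpha>(2) show "q \<in> insert (carrier G) maximal_open_normal \<times> UNIV"
      by simp
  qed
  moreover have "countable (insert (carrier G) maximal_open_normal \<times> (UNIV :: int set))"
    using count by simp
  ultimately show ?thesis
    using countable_subset countable_image_inj_on by blast
qed

end

section \<open>Invariant characters of open normal subgroups\<close>

context compact_group
begin

text \<open>
  On the whole group, invariance follows from commutativity of \<open>\<int>/p\<close>, and continuity only has to be
  checked near the identity.
\<close>
lemma characterI:
  assumes range: "\<alpha> \<in> carrier G \<rightarrow>\<^sub>E {0..<int p}"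
    and hom: "\<And>x y. x \<in> carrier G \<Longrightarrow> y \<in> carrier G \<Longrightarrow> \<alpha> (x \<otimes> y) = (\<alpha> x + \<alpha> y) mod int p"
    and U: "openin T U" "\<one> \<in> U" "\<And>x. x \<in> U \<Longrightarrow> \<alpha> x = 0"
  shows "\<alpha> \<in> invariant_characters (carrier G) p"
proof -
  have red: "\<alpha> x mod int p = \<alpha> x" if "x \<in> carrier G" for x
    using PiE_mem [OF range that] by simp
  have conj: "\<alpha> (g \<otimes> x \<otimes> inv g) = \<alpha> x" if g: "g \<in> carrier G" and x: "x \<in> carrier G" for g x
  proof -
    have "(g \<otimes> x \<otimes> inv g) \<otimes> g = g \<otimes> x"
      using g x by (simp add: m_assoc)
    then have "(\<alpha> (g \<otimes> x \<otimes> inv g) + \<alpha> g) mod int p = (\<alpha> g + \<alpha> x) mod int p"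
      using hom [of "g \<otimes> x \<otimes> inv g" g] hom [OF g x] g x by simp
    then have "\<alpha> (g \<otimes> x \<otimes> inv g) mod int p = \<alpha> x mod int p"
      by (simp add: mod_eq_dvd_iff)
    then show ?thesis
      using red [OF x] red [of "g \<otimes> x \<otimes> inv g"] g x by simp
  qed
  have "subgroup {x \<in> carrier G. \<alpha> x = 0} G"
  proof
    show "\<one> \<in> {x \<in> carrier G. \<alpha> x = 0}"
      using U by simp
    show "x \<otimes> y \<in> {x \<in> carrier G. \<alpha> x = 0}"
      if "x \<in> {x \<in> carrier G. \<alpha> x = 0}" "y \<in> {x \<in> carrier G. \<alpha> x = 0}" for x y
      using that hom by simp
    show "inv x \<in> {x \<in> carrier G. \<alpha> x = 0}" if "x \<in> {x \<in> carrier G. \<alpha> x = 0}" for x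
      using that hom [of x "inv x"] red [of "inv x"] U(2,3) by simp
  qed blast
  moreover have "U \<subseteq> {x \<in> carrier G. \<alpha> x = 0}"
    using U(3) openin_subset [OF U(1)] topspace_eq_carrier by blast
  ultimately have "openin T {x \<in> carrier G. \<alpha> x = 0}"
    using open_subgroupI [OF _ U(1,2)] by blast
  with range hom conj show ?thesis
    by (simp add: invariant_characters_def)
qed

lemma ex_coset_representatives:
  assumes W: "subgroup W G" "openin T W"
  obtains r where "finite (r ` carrier G)"
    "\<And>x. x \<in> carrier G \<Longrightarrow> r x \<in> carrier G"
    "\<And>x. x \<in> carrier G \<Longrightarrow> x \<otimes> inv (r x) \<in> W"
    "\<And>x y. W #> x = W #> y \<Longrightarrow> r x = r y"
proof -
  define r where "r x = (SOME y. y \<in> W #> x)" for x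
  have r: "r x \<in> W #> x" if "x \<in> carrier G" for x
    unfolding r_def by (rule someI [of _ x]) (rule rcos_self [OF that W(1)])
  have c: "r x \<in> carrier G" if "x \<in> carrier G" for x
    using subgroup.elemrcos_carrier [OF W(1) is_group that r [OF that]] .
  show ?thesis
  proof (rule that)
    have "r ` carrier G \<subseteq> (\<lambda>C. SOME y. y \<in> C) ` (rcosets W)"
      using rcosetsI [OF subgroup.subset [OF W(1)]] by (auto simp: r_def)
    then show "finite (r ` carrier G)"
      using finite_rcosets_open_subgroup [OF W] finite_surj by blast
    show "r x \<in> carrier G" if "x \<in> carrier G" for x
      using c that .
    show "x \<otimes> inv (r x) \<in> W" if x: "x \<in> carrier G" for x
    proof -
      have "W #> x = W #> r x"
        using repr_independence [OF r [OF x] x W(1)] .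
      then have "x \<in> W #> r x"
        using rcos_self [OF x W(1)] by simp
      then show ?thesis
        using subgroup.rcos_module_imp [OF W(1) is_group c [OF x]] by blast
    qed
    show "r x = r y" if "W #> x = W #> y" for x y
      using that by (simp add: r_def)
  qed
qed

text \<open>
  Choose representatives \<open>r x\<close> of the cosets of \<open>W\<close> and write \<open>x = w x \<otimes> r x\<close>. Then \<open>w\<close> is
  multiplicative up to conjugation, which invariant characters do not see, and up to the cocycle
  \<open>c x y\<close>, which takes values in a finite set \<open>C\<close>. If \<open>\<rho>\<close> and \<open>\<rho>\<^sub>0\<close> agree on \<open>C\<close>, the map
  \<open>x \<mapsto> \<rho> (w x) - \<rho>\<^sub>0 (w x)\<close> is therefore a character of \<open>G\<close>, and it extends \<open>\<rho> - \<rho>\<^sub>0\<close>. So the fibres of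
  the restriction map \<open>\<rho> \<mapsto> \<rho>|C\<close> are countable, and its image is finite.
\<close>
lemma countable_invariant_characters:
  assumes W: "W \<lhd> G" "openin T W"
    and count: "countable (invariant_characters (carrier G) p)"
  shows "countable (invariant_characters W p)"
proof -
  let ?X = "invariant_characters W p"
  have Ws: "subgroup W G"
    using W(1) normal_imp_subgroup by blast
  note Wc = subgroup.mem_carrier [OF Ws]
  note Wm = subgroup.m_closed [OF Ws]
  note Wi = subgroup.m_inv_closed [OF Ws]
  obtain r where fin: "finite (r ` carrier G)"
    and rc: "\<And>x. x \<in> carrier G \<Longrightarrow> r x \<in> carrier G"
    and rW: "\<And>x. x \<in> carrier G \<Longrightarrow> x \<otimes> inv (r x) \<in> W"
    and reqI: "\<And>x y. W #> x = W #> y \<Longrightarrow> r x = r y"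
    using ex_coset_representatives [OF Ws W(2)] by metis
  define R where "R = r ` carrier G"
  define C where "C = (\<lambda>(a, b, c). a \<otimes> b \<otimes> inv c) ` (R \<times> R \<times> R) \<inter> W"
  define w where "w x = x \<otimes> inv (r x)" for x
  define c where "c x y = r x \<otimes> r y \<otimes> inv (r (x \<otimes> y))" for x y
  have finC: "finite C"
    using fin by (simp add: C_def R_def)
  have wW: "w x \<in> W" if "x \<in> carrier G" for x
    using rW that by (simp add: w_def)
  have conjW: "r x \<otimes> w y \<otimes> inv (r x) \<in> W" if "x \<in> carrier G" "y \<in> carrier G" for x y
    using normal.inv_op_closed2 [OF W(1) rc [OF that(1)] wW [OF that(2)]] .
  have w_mult: "w (x \<otimes> y) = w x \<otimes> (r x \<otimes> w y \<otimes> inv (r x)) \<otimes> c x y"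
    if "x \<in> carrier G" "y \<in> carrier G" for x y
    using that rc by (simp add: w_def c_def m_assoc)
  have cC: "c x y \<in> C" if xy: "x \<in> carrier G" "y \<in> carrier G" for x y
  proof -
    let ?a = "w x \<otimes> (r x \<otimes> w y \<otimes> inv (r x))"
    have a: "?a \<in> W"
      using Wm wW conjW xy by simp
    have "c x y \<in> carrier G"
      using xy rc by (simp add: c_def)
    then have "c x y = inv ?a \<otimes> w (x \<otimes> y)"
      using w_mult [OF xy] Wc [OF a] by simp
    then have "c x y \<in> W"
      using Wm [OF Wi [OF a] wW [of "x \<otimes> y"]] xy by simp
    moreover have "c x y \<in> (\<lambda>(a, b, c). a \<otimes> b \<otimes> inv c) ` (R \<times> R \<times> R)"
      unfolding c_def R_def using xy by (intro image_eqI [of _ _ "(r x, r y, r (x \<otimes> y))"]) auto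
    ultimately show ?thesis
      by (simp add: C_def)
  qed
  have r_on_W: "r x = r \<one>" if "x \<in> W" for x
    using reqI [of x \<one>] subgroup.rcos_const [OF Ws is_group that] subgroup.subset [OF Ws] by simp
  have r1: "r \<one> \<in> C"
    using cC [of \<one> \<one>] rc [of \<one>] by (simp add: c_def m_assoc)
  have CW: "x \<in> W" if "x \<in> C" for x
    using that by (simp add: C_def)
  have \<rho>_w_mult: "\<rho> (w (x \<otimes> y)) = (\<rho> (w x) + \<rho> (w y) + \<rho> (c x y)) mod int p"
    if \<rho>: "\<rho> \<in> ?X" and xy: "x \<in> carrier G" "y \<in> carrier G" for \<rho> x y
  proof -
    note D = invariant_charactersD [OF \<rho>]
    have "\<rho> (w (x \<otimes> y)) = (\<rho> (w x \<otimes> (r x \<otimes> w y \<otimes> inv (r x))) + \<rho> (c x y)) mod int p"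
      unfolding w_mult [OF xy] using D(5) Wm wW conjW xy CW cC by simp
    also have "\<rho> (w x \<otimes> (r x \<otimes> w y \<otimes> inv (r x))) = (\<rho> (w x) + \<rho> (w y)) mod int p"
      using D(5) [OF wW conjW] D(6) [OF rc wW] xy by simp
    finally show ?thesis
      by (simp add: mod_simps)
  qed
  have fiber: "countable {\<rho> \<in> ?X. restrict \<rho> C = restrict \<rho>\<^sub>0 C}" if \<rho>\<^sub>0: "\<rho>\<^sub>0 \<in> ?X" for \<rho>\<^sub>0
  proof (rule countable_subset)
    show "countable ((\<lambda>\<alpha>. \<lambda>x\<in>W. (\<rho>\<^sub>0 x + \<alpha> x) mod int p) ` invariant_characters (carrier G) p)"
      using count by simp
    show "{\<rho> \<in> ?X. restrict \<rho> C = restrict \<rho>\<^sub>0 C} \<subseteq>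
      (\<lambda>\<alpha>. \<lambda>x\<in>W. (\<rho>\<^sub>0 x + \<alpha> x) mod int p) ` invariant_characters (carrier G) p"
    proof
      fix \<rho> assume "\<rho> \<in> {\<rho> \<in> ?X. restrict \<rho> C = restrict \<rho>\<^sub>0 C}"
      then have \<rho>: "\<rho> \<in> ?X" and eq: "restrict \<rho> C = restrict \<rho>\<^sub>0 C"
        by blast+
      have agree: "\<rho> x = \<rho>\<^sub>0 x" if "x \<in> C" for x
        using fun_cong [OF eq, of x] that by simp
      note D = invariant_charactersD [OF \<rho>] and D0 = invariant_charactersD [OF \<rho>\<^sub>0]
      have pos: "0 < int p"
        using D(2,3) [OF subgroup.one_closed [OF Ws]] by linarith
      define \<alpha> where "\<alpha> = (\<lambda>x\<in>carrier G. (\<rho> (w x) - \<rho>\<^sub>0 (w x)) mod int p)"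
      \<comment> \<open>On \<open>W\<close> the representative is the constant \<open>r \<one>\<close>, a cocycle value, which drops out of the
        difference.\<close>
      have \<alpha>W: "\<alpha> x = (\<rho> x - \<rho>\<^sub>0 x) mod int p" if x: "x \<in> W" for x
      proof -
        have "\<sigma> (w x) = (\<sigma> x + (- \<sigma> (r \<one>)) mod int p) mod int p" if \<sigma>: "\<sigma> \<in> ?X" for \<sigma>
          using invariant_charactersD(5) [OF \<sigma> x Wi [OF CW [OF r1]]]
            character_inv [OF \<sigma> Ws CW [OF r1]] by (simp add: w_def r_on_W [OF x])
        from this [OF \<rho>] this [OF \<rho>\<^sub>0] show ?thesis
          using Wc [OF x] agree [OF r1] by (simp add: \<alpha>_def mod_simps)
      qed
      have "\<alpha> \<in> invariant_characters (carrier G) p"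
      proof (rule characterI)
        show "\<alpha> \<in> carrier G \<rightarrow>\<^sub>E {0..<int p}"
          using pos by (auto simp: \<alpha>_def)
        show "\<alpha> (x \<otimes> y) = (\<alpha> x + \<alpha> y) mod int p" if xy: "x \<in> carrier G" "y \<in> carrier G" for x y
        proof -
          have "\<alpha> (x \<otimes> y) = (\<rho> (w x) + \<rho> (w y) + \<rho> (c x y) - (\<rho>\<^sub>0 (w x) + \<rho>\<^sub>0 (w y) + \<rho>\<^sub>0 (c x y))) mod int p"
            using xy \<rho>_w_mult [OF \<rho> xy] \<rho>_w_mult [OF \<rho>\<^sub>0 xy] by (simp add: \<alpha>_def mod_simps)
          also have "\<dots> = ((\<rho> (w x) - \<rho>\<^sub>0 (w x)) + (\<rho> (w y) - \<rho>\<^sub>0 (w y))) mod int p"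
            using agree [OF cC [OF xy]] by (simp add: algebra_simps)
          also have "\<dots> = (\<alpha> x + \<alpha> y) mod int p"
            using xy by (simp add: \<alpha>_def mod_simps)
          finally show ?thesis .
        qed
        let ?U = "{x \<in> W. \<rho> x = 0} \<inter> {x \<in> W. \<rho>\<^sub>0 x = 0}"
        show "openin T ?U"
          using D(7) D0(7) by blast
        show "\<one> \<in> ?U"
          using character_one [OF \<rho> Ws] character_one [OF \<rho>\<^sub>0 Ws] subgroup.one_closed [OF Ws] by simp
        show "\<alpha> x = 0" if "x \<in> ?U" for x
          using that \<alpha>W by simp
      qed
      moreover have "\<rho> = (\<lambda>x\<in>W. (\<rho>\<^sub>0 x + \<alpha> x) mod int p)"
      proof (rule extensionalityI [of _ W])
        show "\<rho> \<in> extensional W"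
          using D(1) .
        show "\<rho> x = (\<lambda>x\<in>W. (\<rho>\<^sub>0 x + \<alpha> x) mod int p) x" if "x \<in> W" for x
          using that \<alpha>W D(4) by (simp add: mod_simps)
      qed simp
      ultimately show "\<rho> \<in> (\<lambda>\<alpha>. \<lambda>x\<in>W. (\<rho>\<^sub>0 x + \<alpha> x) mod int p) ` invariant_characters (carrier G) p"
        by blast
    qed
  qed
  have "(\<lambda>\<rho>. restrict \<rho> C) ` ?X \<subseteq> C \<rightarrow>\<^sub>E {0..<int p}"
    using invariant_charactersD(2,3) CW by fastforce
  moreover have "finite (C \<rightarrow>\<^sub>E {0..<int p})"
    using finC by (simp add: finite_PiE)
  ultimately have fin_data: "finite ((\<lambda>\<rho>. restrict \<rho> C) ` ?X)"
    using finite_subset by blast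
  have "?X = (\<Union>d\<in>(\<lambda>\<rho>. restrict \<rho> C) ` ?X. {\<rho> \<in> ?X. restrict \<rho> C = d})"
    by auto
  moreover have "countable (\<Union>d\<in>(\<lambda>\<rho>. restrict \<rho> C) ` ?X. {\<rho> \<in> ?X. restrict \<rho> C = d})"
    using fiber by (intro countable_UN [OF countable_finite [OF fin_data]]) auto
  ultimately show ?thesis
    by simp
qed

text \<open>
  Two different powers of \<open>u\<close> lie in the same coset, since there are finitely many cosets.
\<close>
lemma ex_power_in_open_subgroup:
  assumes V: "subgroup V G" "openin T V" and u: "u \<in> carrier G"
  obtains n :: nat where "n > 0" "u [^] n \<in> V"
proof -
  have "\<not> inj (\<lambda>n::nat. V #> u [^] n)"
  proof
    assume "inj (\<lambda>n::nat. V #> u [^] n)"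
    moreover have "range (\<lambda>n::nat. V #> u [^] n) \<subseteq> rcosets V"
      using rcosetsI [OF subgroup.subset [OF V(1)]] u by auto
    ultimately have "finite (UNIV :: nat set)"
      using finite_rcosets_open_subgroup [OF V] inj_on_finite by blast
    then show False
      by simp
  qed
  then obtain i j :: nat where ij: "i < j" "V #> u [^] i = V #> u [^] j"
    unfolding inj_on_def by (metis linorder_neqE_nat)
  then have "u [^] j \<in> V #> u [^] i"
    using rcos_self [OF _ V(1), of "u [^] j"] u by simp
  then have "u [^] j \<otimes> inv (u [^] i) \<in> V"
    using subgroup.rcos_module_imp [OF V(1) is_group] u by simp
  moreover have "u [^] j = u [^] (j - i) \<otimes> u [^] i"
    using ij(1) u by (simp add: nat_pow_mult)
  then have "u [^] j \<otimes> inv (u [^] i) = u [^] (j - i)"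
    using u by (simp add: m_assoc)
  ultimately show ?thesis
    using that [of "j - i"] ij(1) by simp
qed

end

section \<open>Counting the open normal subgroups\<close>

context compact_residually_nilpotent_group
begin

text \<open>
  A central element modulo \<open>V\<close> has finite order \<open>n\<close> modulo \<open>V\<close>; its power with exponent \<open>n / p\<close>, for a
  prime divisor \<open>p\<close> of \<open>n\<close>, has order \<open>p\<close>. Centrality is stated for all powers of \<open>u\<close>, as this is the
  form in which the subgroup generated by \<open>u\<close> and \<open>V\<close> is seen to be normal.
\<close>
lemma ex_central_prime_order_modulo:
  assumes N: "V \<lhd> G" and V': "openin T V" "V \<noteq> carrier G"
  obtains u p where "u \<in> carrier G" "u \<notin> V" "prime (p::nat)" "u [^] p \<in> V"
    "\<And>g k. g \<in> carrier G \<Longrightarrow> u [^] (k::int) \<otimes> g \<otimes> inv (u [^] k) \<otimes> inv g \<in> V"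
proof -
  note V = normal_imp_subgroup [OF N] V'
  obtain z where z: "z \<in> carrier G" "z \<notin> V"
    "\<And>g. g \<in> carrier G \<Longrightarrow> z \<otimes> g \<otimes> inv z \<otimes> inv g \<in> V"
    using ex_central_modulo [OF V] by metis
  define n where "n = (LEAST n. n > 0 \<and> z [^] (n::nat) \<in> V)"
  have "\<exists>n::nat. n > 0 \<and> z [^] n \<in> V"
    using ex_power_in_open_subgroup [OF V(1,2) z(1)] by metis
  then have n: "n > 0" "z [^] n \<in> V"
    unfolding n_def by (metis (mono_tags, lifting) LeastI_ex)+
  have least: "z [^] m \<notin> V" if "0 < m" "m < n" for m :: nat
    using not_less_Least [of m "\<lambda>n. n > 0 \<and> z [^] n \<in> V"] that by (simp add: n_def)
  have "n \<noteq> 1"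
    using n z by auto
  then obtain p b where p: "prime p" "n = p * b"
    using prime_factor_nat [of n] by (auto elim: dvdE)
  have b: "0 < b" "b < n"
    using n(1) p prime_gt_1_nat [OF p(1)] by (auto intro: Nat.gr0I)
  let ?u = "z [^] b"
  have "?u [^] p = z [^] n"
    using z(1) p(2) by (simp add: nat_pow_pow mult.commute)
  moreover have "?u [^] (k::int) \<otimes> g \<otimes> inv (?u [^] k) \<otimes> inv g \<in> V"
    if g: "g \<in> carrier G" for k g
  proof -
    \<comment> \<open>The preimage of the centre of the quotient by \<open>V\<close>.\<close>
    let ?Z = "{x \<in> carrier G. \<forall>g\<in>carrier G. x \<otimes> g \<otimes> inv x \<otimes> inv g \<in> V}"
    have Z: "subgroup ?Z G"
    proof
      show "\<one> \<in> ?Z"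
        using subgroup.one_closed [OF V(1)] by simp
    next
      fix x y assume xy: "x \<in> ?Z" "y \<in> ?Z"
      have "x \<otimes> y \<otimes> g \<otimes> inv (x \<otimes> y) \<otimes> inv g \<in> V" if g: "g \<in> carrier G" for g
      proof -
        have "x \<otimes> y \<otimes> g \<otimes> inv (x \<otimes> y) \<otimes> inv g
          = (x \<otimes> (y \<otimes> g \<otimes> inv y \<otimes> inv g) \<otimes> inv x) \<otimes> (x \<otimes> g \<otimes> inv x \<otimes> inv g)"
          using xy g by (simp add: m_assoc inv_mult_group)
        moreover have "x \<otimes> (y \<otimes> g \<otimes> inv y \<otimes> inv g) \<otimes> inv x \<in> V"
          using xy g normal.inv_op_closed2 [OF N] by simp
        ultimately show ?thesis
          using xy g subgroup.m_closed [OF V(1)] by simp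
      qed
      then show "x \<otimes> y \<in> ?Z"
        using xy by simp
    next
      fix x assume x: "x \<in> ?Z"
      have "inv x \<otimes> g \<otimes> inv (inv x) \<otimes> inv g \<in> V" if g: "g \<in> carrier G" for g
      proof -
        have "inv x \<otimes> g \<otimes> inv (inv x) \<otimes> inv g = inv x \<otimes> inv (x \<otimes> g \<otimes> inv x \<otimes> inv g) \<otimes> x"
          using x g by (simp add: m_assoc inv_mult_group)
        then show ?thesis
          using x g normal.inv_op_closed1 [OF N] subgroup.m_inv_closed [OF V(1)] by simp
      qed
      then show "inv x \<in> ?Z"
        using x by simp
    qed blast
    have "z \<in> ?Z"
      using z by simp
    then have "?u \<in> ?Z"
      using subgroup_int_pow_closed [OF Z, of z "int b"] by (simp only: int_pow_int)
    then have "?u [^] k \<in> ?Z"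
      using subgroup_int_pow_closed [OF Z] by blast
    then show ?thesis
      using g by blast
  qed
  ultimately show ?thesis
    using that [of ?u p] z(1) n(2) p(1) least [OF b] by simp
qed

text \<open>
  \<open>W\<close> is generated by \<open>V\<close> and an element \<open>u\<close> that is central of prime order \<open>p\<close> modulo \<open>V\<close>, and the
  character sends \<open>v \<otimes> u [^] k\<close> to \<open>k\<close> modulo \<open>p\<close>.
\<close>
lemma open_normal_is_character_kernel:
  assumes V: "V \<lhd> G" "openin T V" "V \<noteq> carrier G"
  obtains W p \<rho> where "W \<lhd> G" "openin T W" "V \<subset> W" "prime p"
    "\<rho> \<in> invariant_characters W p" "V = {x \<in> W. \<rho> x = 0}"
proof -
  have Vs: "subgroup V G"
    using V(1) normal_imp_subgroup by blast
  note Vc = subgroup.mem_carrier [OF Vs]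
  note Vm = subgroup.m_closed [OF Vs]
  note Vi = subgroup.m_inv_closed [OF Vs]
  obtain u p where u: "u \<in> carrier G" "u \<notin> V" and p: "prime (p::nat)" "u [^] p \<in> V"
    and central: "\<And>g k. g \<in> carrier G \<Longrightarrow> u [^] (k::int) \<otimes> g \<otimes> inv (u [^] k) \<otimes> inv g \<in> V"
    using ex_central_prime_order_modulo [OF V] by metis
  \<comment> \<open>\<open>P x k\<close> says that \<open>x\<close> lies in the coset of \<open>u [^] k\<close>, so \<open>k\<close> modulo \<open>p\<close> is the value at \<open>x\<close>.\<close>
  define P where "P x k \<longleftrightarrow> x \<in> carrier G \<and> x \<otimes> inv (u [^] k) \<in> V" for x and k :: int
  define W where "W = {x. \<exists>k. P x k}"
  define \<rho> where "\<rho> = (\<lambda>x\<in>W. (SOME k. P x k) mod int p)"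
  have P_mult: "P (x \<otimes> y) (j + k)" if "P x j" "P y k" for x y j k
  proof -
    have "x \<otimes> y \<otimes> inv (u [^] (j + k))
      = (x \<otimes> inv (u [^] j)) \<otimes> (u [^] j \<otimes> (y \<otimes> inv (u [^] k)) \<otimes> inv (u [^] j))"
      using that u(1) by (simp add: P_def int_pow_mult inv_mult_group m_assoc)
    moreover have "u [^] j \<otimes> (y \<otimes> inv (u [^] k)) \<otimes> inv (u [^] j) \<in> V"
      using that u(1) normal.inv_op_closed2 [OF V(1)] by (simp add: P_def)
    ultimately show ?thesis
      using that Vm by (simp add: P_def)
  qed
  have P_inv: "P (inv x) (- k)" if "P x k" for x k
  proof -
    have "inv x \<otimes> inv (u [^] (- k)) = inv x \<otimes> inv (x \<otimes> inv (u [^] k)) \<otimes> x"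
      using that u(1) by (simp add: P_def int_pow_neg inv_mult_group m_assoc)
    then show ?thesis
      using that Vi normal.inv_op_closed1 [OF V(1)] by (simp add: P_def)
  qed
  have P_conj: "P (g \<otimes> x \<otimes> inv g) k" if "P x k" and g: "g \<in> carrier G" for x g k
  proof -
    let ?v = "x \<otimes> inv (u [^] k)" and ?c = "u [^] k \<otimes> g \<otimes> inv (u [^] k) \<otimes> inv g"
    have "g \<otimes> x \<otimes> inv g \<otimes> inv (u [^] k) = (g \<otimes> ?v \<otimes> inv g) \<otimes> inv ?c"
      using that u(1) by (simp add: P_def inv_mult_group m_assoc)
    moreover have "g \<otimes> ?v \<otimes> inv g \<in> V"
      using that normal.inv_op_closed2 [OF V(1)] by (simp add: P_def)
    ultimately show ?thesis
      using that Vm Vi [OF central [OF g]] by (simp add: P_def)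
  qed
  have P_0: "P v 0" if "v \<in> V" for v
    using that Vc by (simp add: P_def)
  have P_u: "P u 1"
    using u(1) subgroup.one_closed [OF Vs] by (simp add: P_def)
  have up: "u [^] (int p) \<in> V"
    using p(2) by (simp add: int_pow_int)
  have pow_dvd: "int p dvd i" if i: "u [^] i \<in> V" for i :: int
  proof (rule ccontr)
    assume "\<not> int p dvd i"
    then have "coprime i (int p)"
      using p(1) prime_imp_coprime [of "int p" i] by (simp add: coprime_commute)
    then obtain a b where ab: "a * i + b * int p = 1"
      using bezout_int [of i "int p"] by auto
    have "u = u [^] (i * a + int p * b)"
      using ab u(1) by (simp add: ac_simps)
    also have "\<dots> = (u [^] i) [^] a \<otimes> (u [^] int p) [^] b"
      using u(1) by (simp add: int_pow_mult int_pow_pow)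
    also have "\<dots> \<in> V"
      using Vm subgroup_int_pow_closed [OF Vs] i up by blast
    finally show False
      using u(2) by simp
  qed
  have P_unique: "j mod int p = k mod int p" if "P x j" "P x k" for x j k
  proof -
    have "u [^] (j - k) = inv (x \<otimes> inv (u [^] j)) \<otimes> (x \<otimes> inv (u [^] k))"
      using that u(1) by (simp add: P_def int_pow_diff inv_mult_group m_assoc)
    then have "u [^] (j - k) \<in> V"
      using that Vm Vi by (simp add: P_def)
    then show ?thesis
      using pow_dvd by (simp add: mod_eq_dvd_iff)
  qed
  have \<rho>: "\<rho> x = k mod int p" if "P x k" for x k
  proof -
    have "P x (SOME k. P x k)"
      using that by (rule someI)
    then have "(SOME k. P x k) mod int p = k mod int p"
      using that by (rule P_unique)
    moreover have "x \<in> W"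
      using that by (auto simp: W_def)
    ultimately show ?thesis
      by (simp add: \<rho>_def)
  qed
  have Wn: "W \<lhd> G"
  proof (rule normal_invI)
    show "subgroup W G"
    proof
      show "W \<subseteq> carrier G"
        by (auto simp: W_def P_def)
      show "\<one> \<in> W"
        using P_0 [OF subgroup.one_closed [OF Vs]] by (auto simp: W_def)
      show "x \<otimes> y \<in> W" if "x \<in> W" "y \<in> W" for x y
        using that P_mult unfolding W_def by blast
      show "inv x \<in> W" if "x \<in> W" for x
        using that P_inv unfolding W_def by blast
    qed
    show "g \<otimes> x \<otimes> inv g \<in> W" if "g \<in> carrier G" "x \<in> W" for g x
      using that P_conj unfolding W_def by blast
  qed
  have VW: "V \<subset> W"
    using P_0 P_u u(2) by (auto simp: W_def)
  have ker: "V = {x \<in> W. \<rho> x = 0}"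
  proof
    show "V \<subseteq> {x \<in> W. \<rho> x = 0}"
    proof
      fix v assume v: "v \<in> V"
      then show "v \<in> {x \<in> W. \<rho> x = 0}"
        using \<rho> [OF P_0 [OF v]] VW by auto
    qed
    show "{x \<in> W. \<rho> x = 0} \<subseteq> V"
    proof clarify
      fix x assume x: "x \<in> W" "\<rho> x = 0"
      then obtain k where k: "P x k"
        by (auto simp: W_def)
      then have "int p dvd k"
        using x(2) \<rho> [OF k] by (simp add: dvd_eq_mod_eq_0)
      then obtain m where m: "k = int p * m"
        by (rule dvdE)
      have "u [^] k = (u [^] int p) [^] m"
        using u(1) m by (simp add: int_pow_pow)
      then have uk: "u [^] k \<in> V"
        using subgroup_int_pow_closed [OF Vs up] by simp
      have "x = (x \<otimes> inv (u [^] k)) \<otimes> u [^] k"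
        using k u(1) by (simp add: P_def m_assoc)
      then show "x \<in> V"
        using k uk Vm [of "x \<otimes> inv (u [^] k)" "u [^] k"] by (simp add: P_def)
    qed
  qed
  have "\<rho> \<in> invariant_characters W p"
  proof -
    have "\<rho> \<in> W \<rightarrow>\<^sub>E {0..<int p}"
      using prime_gt_0_nat [OF p(1)] by (auto simp: \<rho>_def)
    moreover have "\<rho> (x \<otimes> y) = (\<rho> x + \<rho> y) mod int p" if xy: "x \<in> W" "y \<in> W" for x y
    proof -
      obtain j k where P: "P x j" "P y k"
        using xy unfolding W_def by blast
      show ?thesis
        unfolding \<rho> [OF P(1)] \<rho> [OF P(2)] \<rho> [OF P_mult [OF P]] by (simp add: mod_simps)
    qed
    moreover have "\<rho> (g \<otimes> x \<otimes> inv g) = \<rho> x" if g: "g \<in> carrier G" and x: "x \<in> W" for g x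
    proof -
      obtain k where P: "P x k"
        using x unfolding W_def by blast
      show ?thesis
        unfolding \<rho> [OF P] \<rho> [OF P_conj [OF P g]] ..
    qed
    ultimately show ?thesis
      using ker V(2) by (simp add: invariant_characters_def)
  qed
  moreover have "openin T W"
    using open_subgroupI [OF normal_imp_subgroup [OF Wn] V(2) subgroup.one_closed [OF Vs]] VW by blast
  ultimately show ?thesis
    using that Wn VW p(1) ker by blast
qed

text \<open>
  Induction on the number of overgroups, a substitute for the index that visibly decreases when \<open>V\<close>
  is replaced by a larger subgroup \<open>W\<close>.
\<close>
lemma countable_open_normal_subgroups:
  assumes count: "\<And>p. prime p \<Longrightarrow> countable (invariant_characters (carrier G) p)"
  shows "countable {V. V \<lhd> G \<and> openin T V}"
proof -
  define \<mu> where "\<mu> V = card {H. subgroup H G \<and> V \<subseteq> H}" for V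
  define \<V> where "\<V> n = {V. V \<lhd> G \<and> openin T V \<and> \<mu> V = n}" for n
  have "countable (\<V> n)" for n
  proof (induction n rule: less_induct)
    case (less n)
    let ?S = "\<lambda>p W. (\<lambda>\<rho>. {x \<in> W. \<rho> x = 0}) ` invariant_characters W p"
    let ?U = "\<Union>m\<in>{..<n}. \<Union>W\<in>\<V> m. \<Union>p\<in>{p. prime p}. ?S p W"
    have "\<V> n \<subseteq> insert (carrier G) ?U"
    proof
      fix V assume V: "V \<in> \<V> n"
      show "V \<in> insert (carrier G) ?U"
      proof (cases "V = carrier G")
        case False
        have V': "V \<lhd> G" "openin T V" "\<mu> V = n"
          using V by (auto simp: \<V>_def)
        have Vs: "subgroup V G"
          using V'(1) normal_imp_subgroup by blast
        obtain W p \<rho> where W: "W \<lhd> G" "openin T W" "V \<subset> W" and p: "prime p"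
          and \<rho>: "\<rho> \<in> invariant_characters W p" "V = {x \<in> W. \<rho> x = 0}"
          using open_normal_is_character_kernel [OF V'(1,2) False] .
        have "{H. subgroup H G \<and> W \<subseteq> H} \<subset> {H. subgroup H G \<and> V \<subseteq> H}"
          using W(3) Vs by blast
        then have "\<mu> W < n"
          using psubset_card_mono [OF finite_overgroups [OF Vs V'(2)]] V'(3) by (simp add: \<mu>_def)
        moreover have "W \<in> \<V> (\<mu> W)"
          using W by (simp add: \<V>_def)
        moreover have "V \<in> ?S p W"
          using \<rho> by blast
        ultimately show ?thesis
          using p by blast
      qed simp
    qed
    moreover have "countable ?U"
    proof (rule countable_UN, simp, rule countable_UN)
      show "countable (\<V> m)" if "m \<in> {..<n}" for m
        using less that by simp
      fix m W assume "W \<in> \<V> m"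
      then have W: "W \<lhd> G" "openin T W"
        by (auto simp: \<V>_def)
      show "countable (\<Union>p\<in>{p. prime p}. ?S p W)"
        using countable_invariant_characters [OF W count]
        by (intro countable_UN countable_image) auto
    qed
    ultimately show ?case
      using countable_subset [of "\<V> n" "insert (carrier G) ?U"] by simp
  qed
  then have "countable (\<Union>n. \<V> n)"
    by (intro countable_UN) auto
  moreover have "{V. V \<lhd> G \<and> openin T V} = (\<Union>n. \<V> n)"
    by (auto simp: \<V>_def)
  ultimately show ?thesis
    by simp
qed

text \<open>
  The map that sends \<open>x\<close> to the family of its cosets is continuous and injective on a compact space,
  hence an embedding into a countable product of discrete spaces.
\<close>
lemma metrizable_if_countable_open_normal_subgroups:
  assumes count: "countable {V. V \<lhd> G \<and> openin T V}"
  shows "metrizable_space T"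
proof -
  define \<V> where "\<V> = {V. V \<lhd> G \<and> openin T V}"
  define e where "e x = (\<lambda>V\<in>\<V>. V #> x)" for x
  let ?Y = "product_topology (\<lambda>V. discrete_topology (rcosets V)) \<V>"
  have \<V>: "subgroup V G" "openin T V" if "V \<in> \<V>" for V
    using that normal_imp_subgroup by (auto simp: \<V>_def)
  have cont_coset: "continuous_map T (discrete_topology (rcosets V)) (\<lambda>x. V #> x)" if V: "V \<in> \<V>" for V
  proof -
    have "openin T {x \<in> topspace T. V #> x \<in> S}" for S
    proof (rule openin_subopen [THEN iffD2], rule ballI)
      fix x assume x: "x \<in> {x \<in> topspace T. V #> x \<in> S}"
      then have xc: "x \<in> carrier G"
        by (simp add: topspace_eq_carrier)
      have "V #> x \<subseteq> {x \<in> topspace T. V #> x \<in> S}"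
      proof
        fix y assume y: "y \<in> V #> x"
        then have "V #> y = V #> x"
          using repr_independence [OF y xc \<V>(1) [OF V]] by simp
        moreover have "y \<in> carrier G"
          using subgroup.elemrcos_carrier [OF \<V>(1) [OF V] is_group xc y] .
        ultimately show "y \<in> {x \<in> topspace T. V #> x \<in> S}"
          using x by (simp add: topspace_eq_carrier)
      qed
      then show "\<exists>Q. openin T Q \<and> x \<in> Q \<and> Q \<subseteq> {x \<in> topspace T. V #> x \<in> S}"
        using open_rcoset [OF \<V>(2) [OF V] xc] rcos_self [OF xc \<V>(1) [OF V]] by blast
    qed
    moreover have "V #> x \<in> rcosets V" if "x \<in> topspace T" for x
      using that rcosetsI [OF subgroup.subset [OF \<V>(1) [OF V]]] by (simp add: topspace_eq_carrier)
    ultimately show ?thesis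
      by (simp add: continuous_map_def)
  qed
  have "continuous_map T ?Y e"
    unfolding continuous_map_componentwise
  proof (intro conjI ballI)
    show "e ` topspace T \<subseteq> extensional \<V>"
      by (auto simp: e_def)
    show "continuous_map T (discrete_topology (rcosets V)) (\<lambda>x. e x V)" if "V \<in> \<V>" for V
      using cont_coset [OF that] that by (simp add: e_def)
  qed
  moreover have "inj_on e (topspace T)"
  proof (rule inj_onI, rule ccontr)
    fix x y assume xy: "x \<in> topspace T" "y \<in> topspace T" "e x = e y" "x \<noteq> y"
    then have c: "x \<in> carrier G" "y \<in> carrier G"
      by (simp_all add: topspace_eq_carrier)
    obtain Q where Q: "openin T Q" "x \<in> Q" "y \<notin> Q"
      using Hausdorff xy unfolding Hausdorff_space_def by (metis disjnt_iff)
    have "\<one> \<in> {z \<in> carrier G. z \<otimes> x \<in> Q}"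
      using Q(2) c by simp
    then obtain V where V: "V \<lhd> G" "openin T V" "V \<subseteq> {z \<in> carrier G. z \<otimes> x \<in> Q}"
      using small_open_normal [OF open_right_translate [OF Q(1) c(1)]] by blast
    then have "V \<in> \<V>"
      by (simp add: \<V>_def)
    then have "V #> x = V #> y"
      using fun_cong [OF xy(3), of V] by (simp add: e_def)
    then have "y \<in> V #> x"
      using rcos_self [OF c(2) \<V>(1) [OF \<open>V \<in> \<V>\<close>]] by simp
    then have "y \<in> Q"
      using V(3) by (auto simp: r_coset_def)
    with Q(3) show False ..
  qed
  moreover have "Hausdorff_space ?Y"
    by (simp add: Hausdorff_space_product_topology)
  ultimately have "embedding_map T ?Y e"
    using compact continuous_imp_embedding_map by blast
  then have "T homeomorphic_space subtopology ?Y (e ` topspace T)"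
    by (rule embedding_map_imp_homeomorphic_space)
  moreover have "countable {V \<in> \<V>. \<not> (\<exists>a. topspace (discrete_topology (rcosets V)) \<subseteq> {a})}"
    using count unfolding \<V>_def by (rule countable_subset [rotated]) blast
  then have "metrizable_space ?Y"
    unfolding metrizable_space_product_topology by simp
  ultimately show ?thesis
    using homeomorphic_metrizable_space metrizable_space_subtopology by blast
qed

end

section \<open>Pronilpotent groups\<close>

lemma hom_lower_central_series:
  assumes h: "h \<in> hom G H" and G: "group G" and H: "group H"
  shows "h ` lower_central_series G n \<subseteq> lower_central_series H n"
proof (induction n)
  case 0
  then show ?case
    using h by (auto simp: hom_def)
next
  case (Suc n)
  interpret group_hom G H h
    using h G H by (simp add: group_hom_def group_hom_axioms_def)
  let ?C = "\<lambda>K n. \<Union>x \<in> lower_central_series K n. \<Union>y \<in> carrier K.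
        {x \<otimes>\<^bsub>K\<^esub> y \<otimes>\<^bsub>K\<^esub> inv\<^bsub>K\<^esub> x \<otimes>\<^bsub>K\<^esub> inv\<^bsub>K\<^esub> y}"
  note Gc = subsetD [OF G.lower_central_series_subset_carrier [of n]]
  have "?C G n \<subseteq> carrier G"
    using Gc by auto
  then have "h ` lower_central_series G (Suc n) = generate H (h ` ?C G n)"
    by (simp add: generate_img)
  also have "h ` ?C G n \<subseteq> ?C H n"
  proof clarify
    fix x y assume x: "x \<in> lower_central_series G n" and y: "y \<in> carrier G"
    have "h (x \<otimes>\<^bsub>G\<^esub> y \<otimes>\<^bsub>G\<^esub> inv\<^bsub>G\<^esub> x \<otimes>\<^bsub>G\<^esub> inv\<^bsub>G\<^esub> y)
      = h x \<otimes>\<^bsub>H\<^esub> h y \<otimes>\<^bsub>H\<^esub> inv\<^bsub>H\<^esub> h x \<otimes>\<^bsub>H\<^esub> inv\<^bsub>H\<^esub> h y"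
      using Gc [OF x] y by simp
    moreover have "h x \<in> lower_central_series H n" "h y \<in> carrier H"
      using Suc x y by auto
    ultimately show "h (x \<otimes>\<^bsub>G\<^esub> y \<otimes>\<^bsub>G\<^esub> inv\<^bsub>G\<^esub> x \<otimes>\<^bsub>G\<^esub> inv\<^bsub>G\<^esub> y) \<in> ?C H n"
      by blast
  qed
  then have "generate H (h ` ?C G n) \<subseteq> generate H (?C H n)"
    by (rule H.mono_generate)
  finally show ?case
    by simp
qed

lemma directed_set_finite_upper_bound:
  assumes dir: "directed_set I leq" and "finite J" "J \<subseteq> I"
  obtains k where "k \<in> I" "\<And>j. j \<in> J \<Longrightarrow> leq j k"
proof -
  have trans: "\<forall>i\<in>I. \<forall>j\<in>I. \<forall>k\<in>I. leq i j \<longrightarrow> leq j k \<longrightarrow> leq i k"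
    using dir unfolding directed_set_def by (elim conjE)
  have bound: "\<forall>i\<in>I. \<forall>j\<in>I. \<exists>k\<in>I. leq i k \<and> leq j k"
    using dir unfolding directed_set_def by (elim conjE)
  have nonempty: "I \<noteq> {}"
    using dir unfolding directed_set_def by (elim conjE)
  have "\<exists>k\<in>I. \<forall>j\<in>J. leq j k"
    using assms(2,3)
  proof (induction J)
    case empty
    then show ?case
      using nonempty by blast
  next
    case (insert j J)
    then obtain k where k: "k \<in> I" "\<forall>i\<in>J. leq i k"
      by auto
    have j: "j \<in> I" and J: "J \<subseteq> I"
      using insert.prems by auto
    obtain l where l: "l \<in> I" "leq k l" "leq j l"
      using bound [rule_format, OF k(1) j] by blast
    have "leq i l" if "i \<in> J" for i
      using trans [rule_format, of i k l] k l that J by blast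
    with l show ?case
      by blast
  qed
  with that show ?thesis
    by blast
qed

text \<open>
  The kernels \<open>N i\<close> of the coordinate maps of the inverse limit have the required properties. A basic
  neighbourhood of the identity constrains only finitely many coordinates, and the kernel at an
  upper bound of these indices is contained in all the corresponding kernels.
\<close>
lemma pronilpotent_imp_small_open_normal:
  fixes G (structure)
  assumes pro: "pronilpotent_group TYPE('i) TYPE('h) G T"
    and U: "openin T U" "\<one> \<in> U"
  shows "\<exists>N n. N \<lhd> G \<and> openin T N \<and> N \<subseteq> U \<and> lower_central_series G n \<subseteq> N"
proof -
  obtain I :: "'i set" and leq and H :: "'i \<Rightarrow> 'h monoid" and \<phi> f where
    top: "topological_group G T" and sys: "inverse_system I leq H \<phi>"
    and nil: "\<And>i. i \<in> I \<Longrightarrow> nilpotent_group (H i)"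
    and iso: "f \<in> iso G (inverse_limit_group I leq H \<phi>)"
    and homeo: "homeomorphic_map T (inverse_limit_topology I leq H \<phi>) f"
    using pro unfolding pronilpotent_group_def by blast
  interpret topological_group G T
    by (rule top)
  let ?L = "inverse_limit_group I leq H \<phi>"
  let ?P = "product_topology (\<lambda>i. discrete_topology (carrier (H i))) I"
  have dir: "directed_set I leq" and grp: "\<And>i. i \<in> I \<Longrightarrow> group (H i)"
    and \<phi>: "\<And>i j. i \<in> I \<Longrightarrow> j \<in> I \<Longrightarrow> leq j i \<Longrightarrow> \<phi> i j \<in> hom (H i) (H j)"
    using sys by (auto simp: inverse_system_def)
  have fL: "f x \<in> carrier ?L" if "x \<in> carrier G" for x
    using iso that by (auto simp: iso_def hom_def)
  have fc: "f x i \<in> carrier (H i)" if "x \<in> carrier G" "i \<in> I" for x i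
    using fL [OF that(1)] that(2) by (auto simp: inverse_limit_group_def)
  have f_compat: "\<phi> i j (f x i) = f x j" if "x \<in> carrier G" "i \<in> I" "j \<in> I" "leq j i" for x i j
    using fL [OF that(1)] that by (auto simp: inverse_limit_group_def)
  have hom: "(\<lambda>x. f x i) \<in> hom G (H i)" if i: "i \<in> I" for i
  proof (rule homI)
    show "f x i \<in> carrier (H i)" if "x \<in> carrier G" for x
      using fc that i by blast
    show "f (x \<otimes> y) i = f x i \<otimes>\<^bsub>H i\<^esub> f y i" if "x \<in> carrier G" "y \<in> carrier G" for x y
    proof -
      have "f (x \<otimes> y) = f x \<otimes>\<^bsub>?L\<^esub> f y"
        using iso that by (auto simp: iso_def hom_def)
      then show ?thesis
        using i by (simp add: inverse_limit_group_def)
    qed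
  qed
  have cont: "continuous_map T (discrete_topology (carrier (H i))) (\<lambda>x. f x i)" if "i \<in> I" for i
  proof -
    have "continuous_map T ?P f"
      using homeomorphic_imp_continuous_map [OF homeo]
      by (simp add: inverse_limit_topology_def continuous_map_in_subtopology)
    then show ?thesis
      using that by (simp add: continuous_map_componentwise)
  qed
  define N where "N i = {x \<in> carrier G. f x i = \<one>\<^bsub>H i\<^esub>}" for i
  have N: "N i \<lhd> G" "openin T (N i)" "\<exists>n. lower_central_series G n \<subseteq> N i" if i: "i \<in> I" for i
  proof -
    interpret gh: group_hom G "H i" "\<lambda>x. f x i"
      using hom [OF i] grp [OF i] is_group by (simp add: group_hom_def group_hom_axioms_def)
    have "N i = kernel G (H i) (\<lambda>x. f x i)"
      by (simp add: N_def kernel_def)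
    then show "N i \<lhd> G"
      using gh.normal_kernel by simp
    have "N i = {x \<in> topspace T. f x i \<in> {\<one>\<^bsub>H i\<^esub>}}"
      by (simp add: N_def topspace_eq_carrier)
    then show "openin T (N i)"
      using openin_continuous_map_preimage [OF cont [OF i], of "{\<one>\<^bsub>H i\<^esub>}"] by simp
    obtain n where "lower_central_series (H i) n = {\<one>\<^bsub>H i\<^esub>}"
      using nil [OF i] by (auto simp: nilpotent_group_def)
    then have "lower_central_series G n \<subseteq> N i"
      using hom_lower_central_series [OF hom [OF i] is_group grp [OF i], of n]
        lower_central_series_subset_carrier [of n] by (auto simp: N_def)
    then show "\<exists>n. lower_central_series G n \<subseteq> N i"
      by blast
  qed
  have "openin (inverse_limit_topology I leq H \<phi>) (f ` U)"
    using homeomorphic_imp_open_map [OF homeo] U(1) by (simp add: open_map_def)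
  then obtain Q where Q: "openin ?P Q" "f ` U = Q \<inter> carrier ?L"
    by (auto simp: inverse_limit_topology_def openin_subtopology)
  then have "f \<one> \<in> Q"
    using U(2) by blast
  then obtain X where X: "finite {i \<in> I. X i \<noteq> carrier (H i)}" "f \<one> \<in> Pi\<^sub>E I X" "Pi\<^sub>E I X \<subseteq> Q"
    using Q(1) unfolding openin_product_topology_alt topspace_discrete_topology by blast
  obtain k where k: "k \<in> I" "\<And>i. i \<in> {i \<in> I. X i \<noteq> carrier (H i)} \<Longrightarrow> leq i k"
    using directed_set_finite_upper_bound [OF dir X(1)] by blast
  have "N k \<subseteq> U"
  proof
    fix x assume x: "x \<in> N k"
    then have xc: "x \<in> carrier G" and xk: "f x k = \<one>\<^bsub>H k\<^esub>"
      by (auto simp: N_def)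
    have "f x i \<in> X i" if i: "i \<in> I" for i
    proof (cases "X i = carrier (H i)")
      case True
      then show ?thesis
        using fc xc i by simp
    next
      case False
      then have le: "leq i k"
        using k(2) i by blast
      have "f x i = \<phi> k i \<one>\<^bsub>H k\<^esub>"
        using f_compat [OF xc k(1) i le] xk by simp
      also have "\<dots> = \<one>\<^bsub>H i\<^esub>"
        using hom_one [OF \<phi> [OF k(1) i le]] grp k(1) i by blast
      also have "\<dots> = f \<one> i"
        using hom_one [OF hom [OF i] is_group grp [OF i]] by simp
      finally show ?thesis
        using X(2) i by auto
    qed
    moreover have "f x \<in> extensional I"
      using fL [OF xc] by (auto simp: inverse_limit_group_def PiE_def)
    ultimately have "f x \<in> Pi\<^sub>E I X"
      by (simp add: PiE_iff)
    then have "f x \<in> Q"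
      using X(3) by blast
    then have "f x \<in> f ` U"
      using Q(2) fL [OF xc] by blast
    moreover have "inj_on f (carrier G)"
      using iso by (simp add: iso_def bij_betw_def)
    ultimately show "x \<in> U"
      using xc openin_subset [OF U(1)] topspace_eq_carrier by (metis inj_on_image_mem_iff)
  qed
  then show ?thesis
    using N [OF k(1)] by blast
qed

theorem proposition7p5:
  fixes G :: "('a, 'b) monoid_scheme" and T :: "'a topology"
  assumes "profinite_group G T"
    and "\<And>D. subgroup D G \<Longrightarrow> T closure_of D = topspace T
          \<Longrightarrow> separable_space (subtopology T D)"
    and "pronilpotent_group TYPE('i) TYPE('h) G T"
  shows "metrizable_space T"
proof -
  interpret topological_group G T
    using assms(1) by (simp add: profinite_group_def)
  interpret compact_residually_nilpotent_group G T
  proof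
    show "compact_space T"
      using assms(1) by (simp add: profinite_group_def)
  qed (rule pronilpotent_imp_small_open_normal [OF assms(3)])
  have "countable maximal_open_normal"
    by (rule countable_maximal_open_normal_if_dense_separable) (rule assms(2))
  then have "countable {V. V \<lhd> G \<and> openin T V}"
    by (intro countable_open_normal_subgroups countable_characters)
  then show ?thesis
    by (rule metrizable_if_countable_open_normal_subgroups)
qed

end
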